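(* Let $\ell\geq 3$ and $r\geq 2$ be integers, and set $$\varepsilon:=\frac{\lfloor r/2\rfloor-1}{\max\{R(P_{\lfloor \ell/3\rfloor},r),\,2\lfloor r/2\rfloor+1\}}.$$ Then $\varepsilon<1/2$ and $$\lfloor r/2\rfloor-\varepsilon\;\leq\; m^*(P_\ell,r)\;<\;\left\lceil \Big(1-\frac{1}{\lceil \ell/2\rceil}\Big)\cdot r+\frac{1}{\lceil \ell/2\rceil}\right\rceil .$$
   Context: All graphs are finite and simple. For a graph $F$ and an integer $r\geq 2$, a graph $G$ is called $(F,r)$-Ramsey if every $r$-coloring of the edges of $G$ contains a monochromatic copy of $F$ (as a not necessarily induced subgraph). For a graph $G$ define $m(G):=\max_{H\subseteq G} e(H)/v(H)$, where the maximum is over all subgraphs $H$ of $G$ with at least one vertex, and $e(H)$, $v(H)$ are the numbers of edges and vertices of $H$. The Ramsey density is $m^*(F,r):=\inf\{m(G) : G \text{ is } (F,r)\text{-Ramsey}\}$. The Ramsey number $R(F,r)$ is the minimal integer $N$ such that the complete graph $K_N$ is $(F,r)$-Ramsey. $P_\ell$ denotes the path with $\ell$ edges. *)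

theory Defs
  imports Complex_Main "HOL-Library.Ramsey" "HOL-Library.FuncSet"
begin

record 'a graph =
  verts :: "'a set"
  edges :: "'a set set"

definition fin_simple_graph :: "'a graph \<Rightarrow> bool" where
  "fin_simple_graph G \<longleftrightarrow> finite (verts G) \<and> edges G \<subseteq> [verts G]\<^bsup>2\<^esup>"

definition subgraph :: "'a graph \<Rightarrow> 'a graph \<Rightarrow> bool" where
  "subgraph H G \<longleftrightarrow> fin_simple_graph H \<and> verts H \<subseteq> verts G \<and> edges H \<subseteq> edges G"

definition graph_iso :: "'a graph \<Rightarrow> 'b graph \<Rightarrow> bool" where
  "graph_iso F H \<longleftrightarrow>
     (\<exists>\<phi>. bij_betw \<phi> (verts F) (verts H) \<and> edges H = (\<lambda>e. \<phi> ` e) ` edges F)"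

definition path_graph :: "nat \<Rightarrow> nat graph" where
  "path_graph l = \<lparr> verts = {0..l}, edges = {{i, Suc i} | i. i < l} \<rparr>"

definition complete_graph :: "nat \<Rightarrow> nat graph" where
  "complete_graph N = \<lparr> verts = {..<N}, edges = [{..<N}]\<^bsup>2\<^esup> \<rparr>"

definition is_ramsey :: "'b graph \<Rightarrow> nat \<Rightarrow> 'a graph \<Rightarrow> bool" where
  "is_ramsey F r G \<longleftrightarrow>
     (\<forall>c. c \<in> edges G \<rightarrow> {..<r} \<longrightarrow>
        (\<exists>H. \<exists>i<r. subgraph H G \<and> graph_iso F H \<and> (\<forall>e\<in>edges H. c e = i)))"

(* The Max is over a finite nonempty set unless G has no vertices. The null graph is never
   (F,r)-Ramsey when F has a vertex, so it does not contribute to ramsey_density. *)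
definition max_density :: "'a graph \<Rightarrow> real" where
  "max_density G =
     Max {real (card (edges H)) / real (card (verts H)) | H. subgraph H G \<and> verts H \<noteq> {}}"

(* Every finite graph is isomorphic to one whose vertices are natural numbers, so the infimum
   may be taken over graphs on subsets of nat. *)
definition ramsey_density :: "'b graph \<Rightarrow> nat \<Rightarrow> real" where
  "ramsey_density F r =
     Inf {max_density G | G :: nat graph. fin_simple_graph G \<and> is_ramsey F r G}"

definition ramsey_number :: "'b graph \<Rightarrow> nat \<Rightarrow> nat" where
  "ramsey_number F r = (LEAST N. is_ramsey F r (complete_graph N))"

end

theory Submission
  imports Defs "HOL-Library.Nat_Bijection"
begin

text \<open>
  Write \<open>k = r div 2\<close> and \<open>L = \<lceil>l / 2\<rceil>\<close>.

  Lower bound. A graph of density at most \<open>k\<close> has an orientation of its edges with all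
  out-degrees at most \<open>k\<close>, so it splits into \<open>k\<close> functional graphs, in each of which a vertex has
  at most one outgoing edge. Two-colour the vertices of a functional graph so that adjacent
  vertices differ, with the inevitable exceptions on odd cycles kept far apart, and give every edge
  the colour of its tail. Away from the exceptions a monochromatic component is a star of edges
  entering one vertex, and an exception lengthens a path by at most one edge; hence no
  monochromatic path has four edges (\<open>coloring_without_mono_P4\<close>). This uses \<open>2 * k \<le> r\<close> colours
  and gives even the density \<open>k\<close> for \<open>l \<ge> 4\<close>. For \<open>l = 3\<close> the exceptions have to be excluded:
  the classes must be forests. As the Ramsey number of a single edge is at most 2, here \<open>\<epsilon>\<close> equals
  \<open>(k - 1) / (2 * k + 1)\<close>, and density below \<open>k - \<epsilon>\<close> forces every set of \<open>x\<close> vertices to span at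
  most \<open>k * (x - 1)\<close> edges (\<open>edges_le_of_density\<close>): sets with \<open>x \<le> 2 * k\<close> cannot span more in any
  graph, and on larger sets \<open>\<epsilon> * x \<ge> k - 1\<close>. By the theorem of Nash-Williams the edges then
  split into \<open>k\<close> forests (\<open>forest_partition\<close>), and \<open>coloring_without_mono_P3\<close> follows. Both
  decompositions come from one transversal theorem of Hall and Rado type
  (\<open>submodular_transversal\<close>), used with the cardinality and with the graphic rank.

  Upper bound. Put \<open>D = r - (r - 1) div L\<close>, which is the ceiling in the theorem. A graph built
  in layers, in which every new vertex is joined to \<open>D\<close> vertices of the preceding layer, has
  density below \<open>D\<close>. Take the richest such graph with \<open>L + 1\<close> layers, in which every \<open>D\<close>-set of
  parents has very many children. In a colouring without a long monochromatic path, every large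
  set of vertices of a layer contains \<open>D\<close> parents that see many children in \<open>D\<close> pairwise
  distinct colours, the same for all those children (\<open>rainbow_parents\<close>). Descending one layer
  therefore loses at most \<open>r - D\<close> colours, and since \<open>L * (r - D) < r\<close> some colour survives all
  \<open>L\<close> steps. It does so along two branches that leave the same top vertex, and together these
  form a monochromatic path with \<open>2 * L \<ge> l\<close> edges (\<open>host_mono_path\<close>).
\<close>

section \<open>Monochromatic paths as lists\<close>

text \<open>
  Lists of vertices can be cut, reversed and concatenated, which is how the long paths below arise;
  the copies and isomorphisms of the definition are met only here.
\<close>

lemma is_ramsey_path_iff:
  assumes G: "fin_simple_graph G" and l: "l \<ge> 1"
  shows "is_ramsey (path_graph l) r G \<longleftrightarrow>
    (\<forall>c \<in> edges G \<rightarrow> {..<r}. \<exists>xs. \<exists>i<r. length xs = Suc l \<and> distinct xs \<and>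
       successively (\<lambda>a b. {a, b} \<in> edges G \<and> c {a, b} = i) xs)"
    (is "?R \<longleftrightarrow> (\<forall>c \<in> _. ?P c)")
proof (intro iffI ballI)
  fix c assume R: ?R and c: "c \<in> edges G \<rightarrow> {..<r}"
  then obtain H i where i: "i < r" and H: "subgraph H G" and iso: "graph_iso (path_graph l) H"
    and mono: "\<forall>e\<in>edges H. c e = i" unfolding is_ramsey_def by blast
  from iso obtain \<phi> where bij: "bij_betw \<phi> {0..l} (verts H)"
    and eH: "edges H = (\<lambda>e. \<phi> ` e) ` {{i, Suc i} | i. i < l}"
    unfolding graph_iso_def path_graph_def by auto
  have e: "{\<phi> t, \<phi> (Suc t)} \<in> edges H" if "t < l" for t
    unfolding eH using that by (intro image_eqI[of _ _ "{t, Suc t}"]) auto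
  let ?xs = "map \<phi> [0..<Suc l]"
  have "distinct ?xs"
    using bij by (auto simp: bij_betw_def distinct_map atLeast0LessThan atLeastLessThanSuc_atLeastAtMost
        simp del: upt_Suc)
  moreover have "successively (\<lambda>a b. {a, b} \<in> edges G \<and> c {a, b} = i) ?xs"
    using e mono H by (auto simp: successively_conv_nth subgraph_def simp del: upt_Suc)
  ultimately show "?P c" using i by (intro exI[of _ ?xs] exI[of _ i]) auto
next
  assume A: "\<forall>c \<in> edges G \<rightarrow> {..<r}. ?P c"
  show ?R unfolding is_ramsey_def
  proof (intro allI impI)
    fix c assume "c \<in> edges G \<rightarrow> {..<r}"
    with A obtain xs i where i: "i < r" and xs: "length xs = Suc l" "distinct xs"
      and s: "successively (\<lambda>a b. {a, b} \<in> edges G \<and> c {a, b} = i) xs" by blast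
    have e: "{xs ! t, xs ! Suc t} \<in> edges G" "c {xs ! t, xs ! Suc t} = i" if "t < l" for t
      using s that xs by (auto simp: successively_conv_nth)
    let ?H = "\<lparr> verts = set xs, edges = {{xs ! t, xs ! Suc t} | t. t < l} \<rparr>"
    have sub: "set xs \<subseteq> verts G"
    proof
      fix x assume "x \<in> set xs"
      then obtain t where t: "t < Suc l" "x = xs ! t" using xs by (metis in_set_conv_nth)
      have "x \<in> {xs ! t, xs ! Suc t} \<or> x \<in> {xs ! (t-1), xs ! Suc (t-1)} \<and> t - 1 < l"
        using t l by auto
      then obtain u where u: "u < l" "x \<in> {xs ! u, xs ! Suc u}"
        using t l by (cases "t < l") (auto, (metis Suc_pred' diff_less less_antisym less_one linorder_not_less order_less_le_trans)+)
      with e(1)[OF u(1)] G show "x \<in> verts G"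
        unfolding fin_simple_graph_def by (auto simp: nsets_def)
    qed
    have "subgraph ?H G"
      using sub e xs by (auto simp: subgraph_def fin_simple_graph_def nth_eq_iff_index_eq)
    moreover have "graph_iso (path_graph l) ?H"
      unfolding graph_iso_def path_graph_def
    proof (intro exI[of _ "nth xs"] conjI)
      show "bij_betw ((!) xs) (verts \<lparr>verts = {0..l}, edges = {{i, Suc i} |i. i < l}\<rparr>) (verts ?H)"
        using bij_betw_nth[OF xs(2), of "{0..l}" "set xs"] xs(1)
        by (simp add: atLeast0AtMost lessThan_Suc_atMost)
    qed (auto simp: image_iff, blast+)
    ultimately show "\<exists>H i. i < r \<and> subgraph H G \<and> graph_iso (path_graph l) H \<and> (\<forall>e\<in>edges H. c e = i)"
      using i e(2) by (intro exI[of _ ?H] exI[of _ i]) auto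
  qed
qed

section \<open>Density\<close>

lemma finite_densities:
  assumes "fin_simple_graph G"
  shows "finite {real (card (edges H)) / real (card (verts H)) | H. subgraph H G \<and> verts H \<noteq> {}}"
proof -
  have fin: "finite (verts G)" "finite (edges G)"
    using assms finite_subset finite_imp_finite_nsets unfolding fin_simple_graph_def by blast+
  have "{real (card (edges H)) / real (card (verts H)) | H. subgraph H G \<and> verts H \<noteq> {}}
    \<subseteq> (\<lambda>(E, V). real (card E) / real (card V)) ` (Pow (edges G) \<times> Pow (verts G))"
    by (auto simp: subgraph_def)
  then show ?thesis by (rule finite_subset) (use fin in auto)
qed

lemma density_le_max_density:
  assumes "fin_simple_graph G" "subgraph H G" "verts H \<noteq> {}"
  shows "real (card (edges H)) / real (card (verts H)) \<le> max_density G"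
  unfolding max_density_def using assms by (intro Max_ge finite_densities) auto

lemma max_density_attained:
  assumes "fin_simple_graph G" "verts G \<noteq> {}"
  obtains H where "subgraph H G" "verts H \<noteq> {}"
    "max_density G = real (card (edges H)) / real (card (verts H))"
proof -
  have "subgraph G G" using assms by (auto simp: subgraph_def)
  then have "max_density G \<in> {real (card (edges H)) / real (card (verts H)) | H. subgraph H G \<and> verts H \<noteq> {}}"
    unfolding max_density_def using assms by (intro Max_in finite_densities) auto
  then show thesis using that by blast
qed

section \<open>A layered host graph\<close>

text \<open>
  Vertices are natural numbers that code a copy index together with the list of their parents, so
  a host graph is determined by its vertex set and every list has as many children as desired.
\<close>

definition pars :: "nat \<Rightarrow> nat list" where
  "pars x = list_decode (snd (prod_decode x))"

definition child :: "nat \<Rightarrow> nat list \<Rightarrow> nat" where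
  "child k S = prod_encode (k, list_encode S)"

lemma pars_child [simp]: "pars (child k S) = S"
  by (simp add: pars_def child_def)

lemma child_eq_iff [simp]: "child k S = child k' S' \<longleftrightarrow> k = k' \<and> S = S'"
  by (metis child_def list_encode_inverse prod.inject prod_encode_eq)

primrec layer :: "nat \<Rightarrow> nat \<Rightarrow> nat \<Rightarrow> nat set" where
  "layer N D 0 = (\<lambda>k. child k []) ` {..<N}"
| "layer N D (Suc i) =
     {child k S | k S. k < N \<and> length S = D \<and> distinct S \<and> set S \<subseteq> layer N D i}"

definition host :: "nat \<Rightarrow> nat \<Rightarrow> nat \<Rightarrow> nat graph" where
  "host N D L = \<lparr> verts = (\<Union>i\<le>L. layer N D i),
     edges = {{x, y} | x y. x \<in> (\<Union>i\<le>L. layer N D i) \<and> y \<in> set (pars x)} \<rparr>"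

lemma finite_layer: "finite (layer N D i)"
proof (induction i)
  case (Suc i)
  have "layer N D (Suc i) \<subseteq> (\<lambda>(k, S). child k S) ` ({..<N} \<times> {S. set S \<subseteq> layer N D i \<and> length S = D})"
    by auto
  then show ?case
    by (rule finite_subset) (use Suc finite_lists_length_eq in auto)
qed auto

lemma layer_disjoint:
  assumes "D > 0" "x \<in> layer N D i" "x \<in> layer N D j"
  shows "i = j"
  using assms(2,3)
proof (induction i arbitrary: x j)
  case 0
  then show ?case using assms(1) by (cases j) auto
next
  case (Suc i)
  then obtain k S where x: "x = child k S" "length S = D" "set S \<subseteq> layer N D i" by auto
  show ?case
  proof (cases j)
    case 0
    then show ?thesis using Suc.prems x assms(1) by auto
  next
    case (Suc j')
    then have "set S \<subseteq> layer N D j'" using Suc.prems x by auto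
    moreover obtain y where "y \<in> set S" using x assms(1) by (cases S) auto
    ultimately show ?thesis using Suc.IH x Suc by auto
  qed
qed

lemma pars_in_layer:
  assumes "x \<in> layer N D i" "y \<in> set (pars x)"
  obtains j where "i = Suc j" "y \<in> layer N D j"
  using assms by (cases i) auto

lemma length_pars_layer: "x \<in> layer N D i \<Longrightarrow> length (pars x) \<le> D"
  by (cases i) auto

lemma host_simple:
  assumes "D > 0"
  shows "fin_simple_graph (host N D L)"
proof -
  have "{x, y} \<in> [\<Union>i\<le>L. layer N D i]\<^bsup>2\<^esup>" if x: "i \<le> L" "x \<in> layer N D i" "y \<in> set (pars x)" for i x y
  proof -
    obtain j where j: "i = Suc j" "y \<in> layer N D j" using x pars_in_layer by blast
    then have "x \<noteq> y" using layer_disjoint[OF assms x(2), of j] by auto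
    moreover have "j \<le> L" using x(1) j(1) by simp
    ultimately show ?thesis using x j(2) by auto
  qed
  then show ?thesis
    unfolding fin_simple_graph_def host_def by (auto simp: finite_layer simp del: doubleton_in_nsets_2)
qed

text \<open>
  Each edge is charged to its endpoint in the deeper layer, which receives at most \<open>D\<close> charges. A
  vertex of the uppermost layer met by the subgraph receives none, and this makes the density of
  the host strictly smaller than \<open>D\<close>.
\<close>

lemma host_subgraph_edges:
  assumes D: "D > 0" and H: "subgraph H (host N D L)" and ne: "verts H \<noteq> {}"
  shows "card (edges H) \<le> D * (card (verts H) - 1)"
proof -
  define P where "P = (\<lambda>i. \<exists>x\<in>verts H. x \<in> layer N D i)"
  have fin: "finite (verts H)" and Hsub: "verts H \<subseteq> (\<Union>i\<le>L. layer N D i)"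
    and eH: "edges H \<subseteq> edges (host N D L)" and eH2: "edges H \<subseteq> [verts H]\<^bsup>2\<^esup>"
    using H by (auto simp: subgraph_def fin_simple_graph_def host_def)
  have "\<exists>i. P i" using ne Hsub unfolding P_def by blast
  then have "P (LEAST i. P i)" by (rule LeastI_ex)
  then obtain v where v: "v \<in> verts H" "v \<in> layer N D (LEAST i. P i)" unfolding P_def by blast
  have "edges H \<subseteq> (\<Union>x\<in>verts H - {v}. (\<lambda>y. {x, y}) ` set (pars x))"
  proof
    fix e assume e: "e \<in> edges H"
    then obtain x y where xy: "e = {x, y}" "y \<in> set (pars x)" using eH by (auto simp: host_def)
    have V: "x \<in> verts H" "y \<in> verts H" using e eH2 xy by auto
    have "x \<noteq> v"
    proof
      assume "x = v"
      then obtain j where "(LEAST i. P i) = Suc j" "y \<in> layer N D j"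
        using pars_in_layer[OF v(2)] xy by blast
      moreover have "P j" using calculation V(2) unfolding P_def by blast
      ultimately show False using Least_le[of P j] by simp
    qed
    then show "e \<in> (\<Union>x\<in>verts H - {v}. (\<lambda>y. {x, y}) ` set (pars x))" using xy V by blast
  qed
  then have "card (edges H) \<le> card (\<Union>x\<in>verts H - {v}. (\<lambda>y. {x, y}) ` set (pars x))"
    using fin by (intro card_mono) auto
  also have "\<dots> \<le> (\<Sum>x\<in>verts H - {v}. card ((\<lambda>y. {x, y}) ` set (pars x)))"
    using fin by (intro card_UN_le) auto
  also have "\<dots> \<le> (\<Sum>x\<in>verts H - {v}. D)"
  proof (intro sum_mono)
    fix x assume "x \<in> verts H - {v}"
    then have "length (pars x) \<le> D" using Hsub length_pars_layer by blast
    then show "card ((\<lambda>y. {x, y}) ` set (pars x)) \<le> D"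
      by (meson List.finite_set card_image_le card_length le_trans)
  qed
  also have "\<dots> = D * (card (verts H) - 1)" using v(1) fin by simp
  finally show ?thesis .
qed

lemma host_density:
  assumes "D > 0" "N > 0"
  shows "max_density (host N D L) < real D"
proof -
  have "child 0 [] \<in> layer N D 0" using assms by auto
  then have "verts (host N D L) \<noteq> {}" unfolding host_def by (simp, blast)
  then obtain H where H: "subgraph H (host N D L)" "verts H \<noteq> {}"
    and m: "max_density (host N D L) = real (card (edges H)) / real (card (verts H))"
    using max_density_attained[OF host_simple[OF assms(1)]] by blast
  have c: "card (verts H) > 0"
    using H by (auto simp: subgraph_def fin_simple_graph_def card_gt_0_iff)
  have "card (edges H) \<le> D * (card (verts H) - 1)" using host_subgraph_edges[OF assms(1) H] .
  also have "\<dots> < D * card (verts H)" using c assms by simp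
  finally have "real (card (edges H)) < real D * real (card (verts H))"
    by (metis of_nat_less_iff of_nat_mult)
  then show ?thesis using m c by (simp add: divide_less_eq)
qed

section \<open>Rainbow parent sets\<close>

definition pairs_arrow :: "nat \<Rightarrow> nat \<Rightarrow> nat \<Rightarrow> bool" where
  "pairs_arrow n s q \<longleftrightarrow> (\<forall>U :: nat set. \<forall>f \<in> [U]\<^bsup>2\<^esup> \<rightarrow> {..<s}. finite U \<and> n \<le> card U \<longrightarrow>
     (\<exists>H i. H \<subseteq> U \<and> card H = q \<and> i < s \<and> (\<forall>e \<in> [H]\<^bsup>2\<^esup>. f e = i)))"

lemma pairs_arrow_exists: "\<exists>n. pairs_arrow n s q"
proof -
  obtain n :: nat where n: "partn_lst {..<n} (replicate s q) 2" using ramsey_full by blast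
  show ?thesis unfolding pairs_arrow_def
  proof (intro exI[of _ n] allI ballI impI)
    fix U :: "nat set" and f
    assume f: "f \<in> [U]\<^bsup>2\<^esup> \<rightarrow> {..<s}" and U: "finite U \<and> n \<le> card U"
    obtain h where h: "bij_betw h {..<card U} U"
      using U ex_bij_betw_nat_finite by (metis atLeast0LessThan)
    then have inj: "inj_on h {..<n}" and im: "h ` {..<n} \<subseteq> U"
      using U by (auto simp: bij_betw_def intro: inj_on_subset)
    have "f \<circ> (`) h \<in> [{..<n}]\<^bsup>2\<^esup> \<rightarrow> {..<length (replicate s q)}"
      using nsets_compose_image_funcset[OF f, of h "{..<n}"] im inj by auto
    then obtain i where i: "i < s" and "monochromatic {..<n} (replicate s q ! i) 2 (f \<circ> (`) h) i"
      using n unfolding partn_lst_def by (metis length_replicate)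
    then obtain H where H: "H \<in> [{..<n}]\<^bsup>q\<^esup>" "(f \<circ> (`) h) ` [H]\<^bsup>2\<^esup> \<subseteq> {i}"
      unfolding monochromatic_def by auto
    have injH: "inj_on h H" using H inj by (auto simp: nsets_def intro: inj_on_subset)
    have "f e = i" if "e \<in> [h ` H]\<^bsup>2\<^esup>" for e
    proof -
      obtain Y where "Y \<in> [H]\<^bsup>2\<^esup>" "e = h ` Y"
        by (rule nset_image_obtains[OF \<open>e \<in> _\<close> injH])
      then show ?thesis using H(2) by (auto simp: image_subset_iff)
    qed
    moreover have "h ` H \<subseteq> U" "card (h ` H) = q"
      using H(1) im injH by (auto simp: nsets_def card_image subset_iff)
    ultimately show "\<exists>H i. H \<subseteq> U \<and> card H = q \<and> i < s \<and> (\<forall>e \<in> [H]\<^bsup>2\<^esup>. f e = i)"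
      using i by blast
  qed
qed

text \<open>
  Consecutive vertices of the list are joined through a common neighbour outside \<open>U\<close>. Fewer than
  \<open>m\<close> vertices outside \<open>U\<close> are ever in use, so a fresh one is always available.
\<close>

lemma path_through_common_neighbours:
  assumes "distinct hs" "hs \<noteq> []" "set hs \<subseteq> U"
    and sym: "\<And>a b. adj a b \<Longrightarrow> adj b a"
    and link: "\<And>a b. a \<in> set hs \<Longrightarrow> b \<in> set hs \<Longrightarrow> a \<noteq> b \<Longrightarrow>
      \<exists>X. X \<inter> U = {} \<and> card X \<ge> m \<and> (\<forall>x\<in>X. adj a x \<and> adj b x)"
    and "length hs \<le> m"
  shows "\<exists>ws. length ws = 2 * length hs - 1 \<and> hd ws = hd hs \<and> distinct ws \<and>
    successively adj ws \<and> set ws \<inter> U \<subseteq> set hs \<and> card (set ws - U) < length hs"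
  using assms(1,2,3,5,6)
proof (induction hs)
  case (Cons a hs)
  have link': "\<exists>X. X \<inter> U = {} \<and> card X \<ge> m \<and> (\<forall>x\<in>X. adj a x \<and> adj b x)"
    if "a \<in> set hs" "b \<in> set hs" "a \<noteq> b" for a b
    by (rule Cons.prems(4)) (use that in auto)
  show ?case
  proof (cases "hs = []")
    case True
    have "set [a] - U = {}" using Cons.prems by auto
    then show ?thesis using True by (intro exI[of _ "[a]"]) auto
  next
    case False
    obtain ws where ws: "length ws = 2 * length hs - 1" "hd ws = hd hs" "distinct ws"
      "successively adj ws" "set ws \<inter> U \<subseteq> set hs" "card (set ws - U) < length hs"
      using Cons.IH[OF _ False _ link'] Cons.prems(1,3,5) by auto
    have b: "hd hs \<in> set hs" "hd hs \<noteq> a" using False Cons.prems(1) by auto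
    then obtain X where X: "X \<inter> U = {}" "card X \<ge> m" "\<forall>x\<in>X. adj a x \<and> adj (hd hs) x"
      using Cons.prems(4)[of a "hd hs"] by auto
    have "\<not> X \<subseteq> set ws - U"
    proof
      assume "X \<subseteq> set ws - U"
      then have "card X \<le> card (set ws - U)" by (intro card_mono) auto
      then show False using X(2) ws(6) Cons.prems(5) by simp
    qed
    then obtain x where x: "x \<in> X" "x \<notin> set ws" "x \<notin> U" using X(1) by blast
    have len: "ws \<noteq> []" using ws(1) False by (cases hs) auto
    have a: "a \<notin> set ws" "a \<in> U" using ws(5) Cons.prems(1,3) by auto
    let ?ws = "a # x # ws"
    have "set ?ws - U = insert x (set ws - U)" using a x by auto
    then have "card (set ?ws - U) < length (a # hs)" using x ws(6) by simp
    moreover have "successively adj ?ws"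
      using X(3) x(1) ws(2,4) len sym by (cases ws) auto
    moreover have "length ?ws = 2 * length (a # hs) - 1" using ws(1) False by (cases hs) auto
    moreover have "distinct ?ws" using a x ws(3) by auto
    moreover have "set ?ws \<inter> U \<subseteq> set (a # hs)" using ws(5) x by auto
    ultimately show ?thesis by (intro exI[of _ ?ws]) simp
  qed
qed simp

definition mono_adj :: "'a graph \<Rightarrow> ('a set \<Rightarrow> nat) \<Rightarrow> nat \<Rightarrow> 'a \<Rightarrow> 'a \<Rightarrow> bool" where
  "mono_adj G c i a b \<longleftrightarrow> {a, b} \<in> edges G \<and> c {a, b} = i"

lemma mono_adj_sym: "mono_adj G c i a b \<longleftrightarrow> mono_adj G c i b a"
  by (simp add: mono_adj_def insert_commute)

definition mono_path :: "'a graph \<Rightarrow> ('a set \<Rightarrow> nat) \<Rightarrow> nat \<Rightarrow> 'a list \<Rightarrow> bool" where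
  "mono_path G c i xs \<longleftrightarrow> distinct xs \<and> successively (mono_adj G c i) xs"

text \<open>
  There are at most \<open>r ^ D\<close> ways to colour the edges from a child to its \<open>D\<close> parents; the
  pigeonhole principle is applied to the \<open>N\<close> children of \<open>S\<close>.
\<close>

lemma children_with_constant_pattern:
  assumes c: "c \<in> edges (host N D L) \<rightarrow> {..<r}" and r: "r > 0"
    and N: "N \<ge> m * r ^ D" and i: "i < L"
    and S: "length S = D" "distinct S" "set S \<subseteq> layer N D i"
  shows "\<exists>X g. X \<subseteq> layer N D (Suc i) \<and> card X \<ge> m \<and> g \<in> set S \<rightarrow> {..<r} \<and>
    (\<forall>x\<in>X. pars x = S \<and> (\<forall>y\<in>set S. mono_adj (host N D L) c (g y) y x))"
proof -
  define pat where "pat k = restrict (\<lambda>y. c {child k S, y}) (set S)" for k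
  have ch: "child k S \<in> layer N D (Suc i)" if "k < N" for k using that S by auto
  have ed: "{child k S, y} \<in> edges (host N D L)" if "k < N" "y \<in> set S" for k y
  proof -
    have "child k S \<in> (\<Union>i\<le>L. layer N D i)" using ch[OF that(1)] i by (metis UN_I Suc_leI atMost_iff)
    moreover have "y \<in> set (pars (child k S))" using that by simp
    ultimately show ?thesis unfolding host_def graph.simps by (intro CollectI exI conjI) (rule refl)
  qed
  have "pat \<in> {..<N} \<rightarrow> (set S \<rightarrow>\<^sub>E {..<r})"
    using c ed by (auto simp: pat_def Pi_iff)
  moreover have "card (set S \<rightarrow>\<^sub>E {..<r}) = r ^ D"
    using S by (simp add: card_PiE distinct_card)
  moreover have "finite (set S \<rightarrow>\<^sub>E {..<r})" by (intro finite_PiE) auto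
  moreover have "set S \<rightarrow>\<^sub>E {..<r} \<noteq> {}" using r by (auto simp: PiE_eq_empty_iff)
  ultimately obtain g where g: "g \<in> set S \<rightarrow>\<^sub>E {..<r}"
    and big: "card (pat -` {g} \<inter> {..<N}) * r ^ D \<ge> N"
    using pigeonhole_card[of pat "{..<N}" "set S \<rightarrow>\<^sub>E {..<r}"] by auto
  define X where "X = (\<lambda>k. child k S) ` (pat -` {g} \<inter> {..<N})"
  have "card X = card (pat -` {g} \<inter> {..<N})"
    unfolding X_def by (intro card_image) (auto simp: inj_on_def)
  moreover have "m * r ^ D \<le> card (pat -` {g} \<inter> {..<N}) * r ^ D" using big N by linarith
  ultimately have "card X \<ge> m" using r by simp
  moreover have "mono_adj (host N D L) c (g y) y x" if x: "x \<in> X" and y: "y \<in> set S" for x y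
  proof -
    obtain k where k: "k < N" "pat k = g" "x = child k S" using x unfolding X_def by auto
    have "c {x, y} = g y" using k(2,3) y unfolding pat_def by (metis restrict_apply')
    then show ?thesis using ed[OF k(1) y] k(3) by (simp add: mono_adj_def insert_commute)
  qed
  ultimately show ?thesis using g ch
    by (intro exI[of _ X] exI[of _ g]) (auto simp: X_def)
qed

text \<open>
  Suppose that every \<open>D\<close>-subset of \<open>U\<close> sees two of its members through the same colour. Call a
  pair linked in a colour if it has many common children joined to both in that colour; then
  every \<open>D\<close>-subset contains a linked pair. Colour each pair with one of its link colours, or with
  the extra colour \<open>r\<close> if it is not linked. Ramsey's theorem yields a large homogeneous set. Its
  colour is not \<open>r\<close>, so it is a clique of pairs linked in a single colour, and a path alternating
  between the clique and common children is monochromatic with \<open>2 * L\<close> edges.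
\<close>

lemma rainbow_parents:
  assumes c: "c \<in> edges (host N D L) \<rightarrow> {..<r}" and r: "r > 0" and D: "D > 0"
    and N: "N \<ge> m * r ^ D" and i: "i < L" and m: "m \<ge> Suc L"
    and n: "pairs_arrow n (Suc r) (D + Suc L)"
    and U: "U \<subseteq> layer N D i" "card U \<ge> n"
    and no_path: "\<not> (\<exists>a<r. \<exists>xs. length xs = Suc (2 * L) \<and> mono_path (host N D L) c a xs)"
  obtains S X g where "length S = D" "distinct S" "set S \<subseteq> U"
    "X \<subseteq> layer N D (Suc i)" "card X \<ge> m" "inj_on g (set S)" "g \<in> set S \<rightarrow> {..<r}"
    "\<And>x. x \<in> X \<Longrightarrow> pars x = S"
    "\<And>x y. x \<in> X \<Longrightarrow> y \<in> set S \<Longrightarrow> mono_adj (host N D L) c (g y) y x"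
proof (rule ccontr)
  assume "\<not> thesis"
  note contra = this and rainbow = that
  let ?adj = "mono_adj (host N D L) c"
  define linked where "linked a e \<longleftrightarrow> (\<exists>X. X \<subseteq> layer N D (Suc i) \<and> card X \<ge> m \<and>
      (\<forall>x\<in>X. \<forall>y\<in>e. ?adj a y x))" for a e
  define f where "f e = (if \<exists>a<r. linked a e then LEAST a. a < r \<and> linked a e else r)" for e
  have f: "f e < r \<and> linked (f e) e" if "a < r" "linked a e" for a e
  proof -
    have "f e = (LEAST a. a < r \<and> linked a e)" unfolding f_def using that by (intro if_P) blast
    then show ?thesis using LeastI[of "\<lambda>a. a < r \<and> linked a e" a] that by simp
  qed
  have "f e < Suc r" for e
  proof (cases "\<exists>a<r. linked a e")
    case True
    then show ?thesis using f[of _ e] less_SucI by blast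
  next
    case False
    then have "f e = r" unfolding f_def by (rule if_not_P)
    then show ?thesis by simp
  qed
  then have "f \<in> [U]\<^bsup>2\<^esup> \<rightarrow> {..<Suc r}" by auto
  moreover have "finite U" using U(1) finite_layer finite_subset by blast
  ultimately obtain H t where H: "H \<subseteq> U" "card H = D + Suc L" "\<forall>e \<in> [H]\<^bsup>2\<^esup>. f e = t"
    using n[unfolded pairs_arrow_def, rule_format, of f U] U(2) by blast
  have finH: "finite H" using H(2) by (simp add: card_ge_0_finite)
  have linkD: "\<exists>y z. y \<in> set S \<and> z \<in> set S \<and> y \<noteq> z \<and> (\<exists>a<r. linked a {y, z})"
    if S: "length S = D" "distinct S" "set S \<subseteq> U" for S
  proof -
    obtain X g where X: "X \<subseteq> layer N D (Suc i)" "card X \<ge> m" "g \<in> set S \<rightarrow> {..<r}"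
      "\<forall>x\<in>X. pars x = S \<and> (\<forall>y\<in>set S. ?adj (g y) y x)"
      using children_with_constant_pattern[OF c r N i S(1,2)] S(3) U(1) by blast
    then have "\<not> inj_on g (set S)" using contra rainbow[OF S X(1,2) _ X(3)] X(4) by blast
    then obtain y z where yz: "y \<in> set S" "z \<in> set S" "y \<noteq> z" "g y = g z"
      by (auto simp: inj_on_def)
    have "\<forall>x\<in>X. ?adj (g y) y x \<and> ?adj (g y) z x" using X(4) yz by metis
    then have "linked (g y) {y, z}" unfolding linked_def using X(1,2) by blast
    moreover have "g y < r" using X(3) yz(1) by auto
    ultimately show ?thesis using yz by blast
  qed
  obtain S where S: "set S \<subseteq> H" "distinct S" "length S = D"
  proof -
    obtain T where T: "T \<subseteq> H" "card T = D" using H(2) by (metis le_add1 obtain_subset_with_card_n)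
    then obtain S where "set S = T" "distinct S" using finH finite_distinct_list finite_subset by metis
    then show thesis using that T distinct_card by metis
  qed
  obtain y z a where yz: "y \<in> set S" "z \<in> set S" "y \<noteq> z" "a < r" "linked a {y, z}"
    using linkD[of S] S H(1) by blast
  have "{y, z} \<in> [H]\<^bsup>2\<^esup>" using yz S(1) by auto
  then have t: "t < r" using H(3) f[OF yz(4,5)] by auto
  have link: "linked t {y, z}" if "y \<in> H" "z \<in> H" "y \<noteq> z" for y z
  proof -
    have "f {y, z} = t" using that H(3) by auto
    then have "\<exists>a<r. linked a {y, z}" using t unfolding f_def by (metis nat_neq_iff)
    then show ?thesis using f \<open>f {y, z} = t\<close> by blast
  qed
  obtain hs where hs: "set hs \<subseteq> H" "distinct hs" "length hs = Suc L"
  proof -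
    obtain T where T: "T \<subseteq> H" "card T = Suc L" using H(2) by (metis le_add2 obtain_subset_with_card_n)
    then obtain S where "set S = T" "distinct S" using finH finite_distinct_list finite_subset by metis
    then show thesis using that T distinct_card by metis
  qed
  have disj: "X \<inter> U = {}" if "X \<subseteq> layer N D (Suc i)" for X
    using that U(1) layer_disjoint[OF D] by (metis (no_types, opaque_lifting) disjoint_iff n_not_Suc_n subset_iff)
  have "\<exists>X. X \<inter> U = {} \<and> card X \<ge> m \<and> (\<forall>x\<in>X. ?adj t a x \<and> ?adj t b x)"
    if "a \<in> set hs" "b \<in> set hs" "a \<noteq> b" for a b
    using link[of a b] that hs(1) disj unfolding linked_def by (metis insertCI subsetD)
  then have "\<exists>ws. length ws = 2 * length hs - 1 \<and> hd ws = hd hs \<and> distinct ws \<and>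
    successively (?adj t) ws \<and> set ws \<inter> U \<subseteq> set hs \<and> card (set ws - U) < length hs"
    using hs H(1) m by (intro path_through_common_neighbours) (auto simp: mono_adj_sym)
  then show False using no_path t hs(3) by (auto simp: mono_path_def)
qed

section \<open>Descending paths\<close>

text \<open>
  \<open>desc U j\<close> consists of the vertices whose ancestors \<open>j\<close> generations back all lie in \<open>U\<close>. It
  serves to see that paths descending from disjoint sets are disjoint.
\<close>

primrec desc :: "nat set \<Rightarrow> nat \<Rightarrow> nat set" where
  "desc U 0 = U"
| "desc U (Suc j) = {x. pars x \<noteq> [] \<and> set (pars x) \<subseteq> desc U j}"

lemma desc_shift:
  assumes "X \<subseteq> desc U 1"
  shows "desc X t \<subseteq> desc U (Suc t)"
  using assms by (induction t) auto

lemma desc_disjoint: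
  assumes "U \<inter> U' = {}"
  shows "desc U t \<inter> desc U' t = {}"
proof (induction t)
  case (Suc t)
  show ?case
  proof (rule ccontr)
    assume "\<not> ?thesis"
    then obtain x where "pars x \<noteq> []" "set (pars x) \<subseteq> desc U t \<inter> desc U' t" by auto
    then show False using Suc by simp
  qed
qed (use assms in auto)

text \<open>
  A path of colour \<open>a\<close> that starts in \<open>U\<close>, a subset of layer \<open>i\<close>, and goes down one layer per step.
\<close>

definition descends :: "nat \<Rightarrow> nat \<Rightarrow> nat \<Rightarrow> (nat set \<Rightarrow> nat) \<Rightarrow> nat set \<Rightarrow> nat \<Rightarrow> nat \<Rightarrow> nat \<Rightarrow> nat list \<Rightarrow> bool"
  where "descends N D L c U i j a vs \<longleftrightarrow> length vs = Suc j \<and>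
    (\<forall>t\<le>j. vs ! t \<in> desc U t \<inter> layer N D (i + t)) \<and> successively (mono_adj (host N D L) c a) vs"

text \<open>
  Rainbow parents in \<open>U\<close> prolong upwards every path that descends from the set of their common
  children, provided its colour is among the \<open>D\<close> colours of the pattern. So each layer costs at
  most \<open>r - D\<close> colours. The bound is arranged without subtraction: it says that at least
  \<open>r - j * (r - D)\<close> colours remain.
\<close>

lemma many_descending_colors:
  assumes c: "c \<in> edges (host N D L) \<rightarrow> {..<r}" and r: "r > 0" and D: "D > 0"
    and N: "N \<ge> m * r ^ D" and m: "m \<ge> Suc L" "m \<ge> n"
    and n: "pairs_arrow n (Suc r) (D + Suc L)"
    and n0: "n > 0"
    and no_path: "\<not> (\<exists>a<r. \<exists>xs. length xs = Suc (2 * L) \<and> mono_path (host N D L) c a xs)"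
    and U: "U \<subseteq> layer N D i" "card U \<ge> n" and ij: "i + j \<le> L"
  shows "r + j * D \<le> card {a\<in>{..<r}. \<exists>vs. descends N D L c U i j a vs} + j * r"
  using U ij
proof (induction j arbitrary: i U)
  case 0
  then obtain u where u: "u \<in> U" "u \<in> layer N D i"
    using n0 by (metis card.empty equals0I less_le_not_le subsetD)
  have "descends N D L c U i 0 a [u]" for a using u by (simp add: descends_def)
  then have "{a\<in>{..<r}. \<exists>vs. descends N D L c U i 0 a vs} = {..<r}" by auto
  then show ?case by simp
next
  case (Suc j)
  have "i < L" using Suc.prems by simp
  from rainbow_parents[OF c r D N this m(1) n Suc.prems(1,2) no_path]
  obtain S X g where S: "length S = D" "distinct S" "set S \<subseteq> U"
    and X: "X \<subseteq> layer N D (Suc i)" "card X \<ge> m"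
    and g: "inj_on g (set S)" "g \<in> set S \<rightarrow> {..<r}"
    and Xp: "\<And>x. x \<in> X \<Longrightarrow> pars x = S"
    and adj: "\<And>x y. x \<in> X \<Longrightarrow> y \<in> set S \<Longrightarrow> mono_adj (host N D L) c (g y) y x"
    by blast
  let ?K = "{a\<in>{..<r}. \<exists>vs. descends N D L c X (Suc i) j a vs}"
  let ?K' = "{a\<in>{..<r}. \<exists>vs. descends N D L c U i (Suc j) a vs}"
  have IH: "r + j * D \<le> card ?K + j * r"
    using Suc.IH[OF X(1)] X(2) m(2) Suc.prems(3) by simp
  have Xd: "X \<subseteq> desc U 1" using Xp S D by auto
  have "g ` set S \<inter> ?K \<subseteq> ?K'"
  proof
    fix a assume a: "a \<in> g ` set S \<inter> ?K"
    then obtain y vs where y: "y \<in> set S" "g y = a" and vs: "descends N D L c X (Suc i) j a vs" by auto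
    have "vs ! 0 \<in> X" "vs \<noteq> []" using vs by (auto simp: descends_def)
    then have "mono_adj (host N D L) c a y (hd vs)" using adj[of "vs ! 0" y] y by (simp add: hd_conv_nth)
    moreover have "(y # vs) ! t \<in> desc U t \<inter> layer N D (i + t)" if "t \<le> Suc j" for t
    proof (cases t)
      case 0
      then show ?thesis using y S(3) Suc.prems(1) by auto
    next
      case (Suc t')
      then have "vs ! t' \<in> desc X t' \<inter> layer N D (Suc i + t')"
        using vs that unfolding descends_def by simp
      then show ?thesis using desc_shift[OF Xd, of t'] Suc by (simp del: desc.simps layer.simps) blast
    qed
    ultimately have "descends N D L c U i (Suc j) a (y # vs)"
      using vs unfolding descends_def by (auto simp: successively_Cons)
    then show "a \<in> ?K'" using a by auto
  qed
  then have 1: "card (g ` set S \<inter> ?K) \<le> card ?K'" by (intro card_mono) auto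
  have "card (g ` set S \<union> ?K) \<le> r"
    using g(2) by (intro card_mono[of "{..<r}", simplified]) auto
  moreover have "card (g ` set S) = D" using g(1) S by (simp add: card_image distinct_card)
  ultimately have "D + card ?K \<le> r + card (g ` set S \<inter> ?K)"
    using card_Un_Int[of "g ` set S" ?K] by simp
  then show ?case using IH 1 by simp
qed

text \<open>
  A single descending path has only \<open>L\<close> edges. To double it, the children of a rainbow set of top
  vertices are cut into more than \<open>2 ^ r\<close> parts. Two of the parts admit the same set of
  descending colours; one of these colours also occurs in the top pattern, and the top vertex
  of that colour joins a descending path in one part to one in the other.
\<close>

lemma host_mono_path:
  assumes c: "c \<in> edges (host N D L) \<rightarrow> {..<r}" and r: "r > 0" and D: "D > 0" "D \<le> r"
    and L: "L > 0" and rL: "L * (r - D) < r"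
    and N: "N \<ge> m * r ^ D" "N \<ge> n" and m: "m \<ge> Suc L" "m \<ge> Suc (2 ^ r) * n"
    and n: "pairs_arrow n (Suc r) (D + Suc L)"
    and n0: "n > 0"
  shows "\<exists>a<r. \<exists>xs. length xs = Suc (2 * L) \<and> mono_path (host N D L) c a xs"
proof (rule ccontr)
  assume no_path: "\<not> ?thesis"
  have mn: "m \<ge> n" using m(2) by simp
  have "card (layer N D 0) = N" by (simp add: card_image inj_on_def)
  with rainbow_parents[OF c r D(1) N(1) L m(1) n order_refl _ no_path]
  obtain S X g where S: "length S = D" "distinct S" "set S \<subseteq> layer N D 0"
    and X: "X \<subseteq> layer N D (Suc 0)" "card X \<ge> m"
    and g: "inj_on g (set S)" "g \<in> set S \<rightarrow> {..<r}"
    and Xp: "\<And>x. x \<in> X \<Longrightarrow> pars x = S"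
    and adj: "\<And>x y. x \<in> X \<Longrightarrow> y \<in> set S \<Longrightarrow> mono_adj (host N D L) c (g y) y x"
    using N(2) by metis
  define M where "M = Suc (2 ^ r)"
  have finX: "finite X" using X(1) finite_layer finite_subset by blast
  obtain h where h: "bij_betw h {..<card X} X"
    using finX ex_bij_betw_nat_finite by (metis atLeast0LessThan)
  define part where "part t = h ` {t * n..<Suc t * n}" for t
  have ran: "{t * n..<Suc t * n} \<subseteq> {..<card X}" if "t < M" for t
  proof -
    have "Suc t * n \<le> M * n" using that by (intro mult_le_mono1) simp
    then have "Suc t * n \<le> card X" using m(2) X(2) unfolding M_def by linarith
    then show ?thesis by auto
  qed
  have partX: "part t \<subseteq> X" if "t < M" for t
    using ran[OF that] h unfolding part_def bij_betw_def by blast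
  have partn: "card (part t) = n" if "t < M" for t
  proof -
    have "inj_on h {t * n..<Suc t * n}" using ran[OF that] h inj_on_subset unfolding bij_betw_def by blast
    then show ?thesis unfolding part_def by (simp add: card_image)
  qed
  have part_disj: "part t \<inter> part t' = {}" if "t < M" "t' < M" "t \<noteq> t'" for t t'
  proof -
    have "{t * n..<Suc t * n} \<inter> {t' * n..<Suc t' * n} = {}"
    proof (rule ccontr)
      assume "\<not> ?thesis"
      then obtain x where x: "t * n \<le> x" "x < Suc t * n" "t' * n \<le> x" "x < Suc t' * n"
        by (metis IntE atLeastLessThan_iff equals0I)
      have "x div n = t" "x div n = t'" using x by (auto intro!: div_nat_eqI simp: mult.commute)
      then show False using that by simp
    qed
    then show ?thesis
      using inj_on_image_Int[of h "{..<card X}", OF _ ran[OF that(1)] ran[OF that(2)]] h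
      unfolding part_def bij_betw_def by auto
  qed
  define K where "K t = {a\<in>{..<r}. \<exists>vs. descends N D L c (part t) (Suc 0) (L - 1) a vs}" for t
  have K: "r + (L - 1) * D \<le> card (K t) + (L - 1) * r" if "t < M" for t
    unfolding K_def
    using many_descending_colors[OF c r D(1) N(1) m(1) mn n n0 no_path, of "part t" "Suc 0" "L - 1"]
      partX[OF that] X(1) partn[OF that] L by auto
  have "\<not> inj_on K {..<M}"
  proof
    assume "inj_on K {..<M}"
    then have "card {..<M} \<le> card (Pow {..<r})" by (rule card_inj_on_le) (auto simp: K_def)
    then show False by (simp add: card_Pow M_def)
  qed
  then obtain t t' where t: "t < M" "t' < M" "t \<noteq> t'" "K t = K t'" by (auto simp: inj_on_def)
  have "g ` set S \<inter> K t \<noteq> {}"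
  proof
    assume "g ` set S \<inter> K t = {}"
    then have "card (g ` set S \<union> K t) = D + card (K t)"
      using g(1) S by (subst card_Un_disjoint) (auto simp: K_def card_image distinct_card)
    moreover have "card (g ` set S \<union> K t) \<le> r"
      using g(2) by (intro card_mono[of "{..<r}", simplified]) (auto simp: K_def)
    ultimately have "D + card (K t) \<le> r" by simp
    then have "D + (r + (L - 1) * D) \<le> r + (L - 1) * r" using K[OF t(1)] by linarith
    moreover have "L * D + r > L * r" using rL D(2) by (simp add: diff_mult_distrib2)
    ultimately show False using L by (cases L) auto
  qed
  then obtain y a where y: "y \<in> set S" "g y = a" "a \<in> K t" "a \<in> K t'" using t(4) by auto
  then obtain vs ws where vs: "descends N D L c (part t) (Suc 0) (L - 1) a vs"
    and ws: "descends N D L c (part t') (Suc 0) (L - 1) a ws" and a: "a < r"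
    by (auto simp: K_def)
  have len: "length vs = L" "length ws = L" using vs ws L by (auto simp: descends_def)
  have lay: "vs ! k \<in> desc (part t) k \<inter> layer N D (Suc k)" "ws ! k \<in> desc (part t') k \<inter> layer N D (Suc k)"
    if "k < L" for k
    using that vs ws by (auto simp: descends_def)
  have y0: "y \<in> layer N D 0" using y(1) S(3) by blast
  have "vs ! k \<noteq> vs ! k'" "ws ! k \<noteq> ws ! k'" if "k < L" "k' < L" "k \<noteq> k'" for k k'
    using lay[OF that(1)] lay[OF that(2)] layer_disjoint[OF D(1)] that(3) by (metis Int_iff Suc_inject)+
  then have dist: "distinct vs" "distinct ws" using len by (auto simp: distinct_conv_nth)
  have "vs ! k \<noteq> ws ! k'" if "k < L" "k' < L" for k k'
  proof (cases "k = k'")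
    case True
    then show ?thesis using lay[OF that(1)] desc_disjoint[OF part_disj[OF t(1-3)], of k] by auto
  next
    case False
    then show ?thesis using lay[OF that(1)] lay[OF that(2)] layer_disjoint[OF D(1)] by (metis Int_iff Suc_inject)
  qed
  then have disj: "set vs \<inter> set ws = {}" using len unfolding disjoint_iff in_set_conv_nth by metis
  have "vs ! k \<noteq> y" "ws ! k \<noteq> y" if "k < L" for k
    using lay[OF that] y0 layer_disjoint[OF D(1)] by (metis Int_iff nat.distinct(1))+
  then have ynot: "y \<notin> set vs" "y \<notin> set ws" using len by (auto simp: in_set_conv_nth)
  have "hd vs \<in> X" "hd ws \<in> X" "vs \<noteq> []" "ws \<noteq> []"
  proof -
    show "vs \<noteq> []" "ws \<noteq> []" using len L by auto
    moreover have "vs ! 0 \<in> X" "ws ! 0 \<in> X"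
      using lay[OF L] partX[OF t(1)] partX[OF t(2)] by auto
    ultimately show "hd vs \<in> X" "hd ws \<in> X" by (simp_all add: hd_conv_nth)
  qed
  then have ends: "mono_adj (host N D L) c a y (hd vs)" "mono_adj (host N D L) c a y (hd ws)"
    using adj y by auto
  let ?xs = "rev vs @ y # ws"
  have "successively (mono_adj (host N D L) c a) ?xs"
    using ends vs ws unfolding descends_def
    by (auto simp: successively_append_iff successively_Cons last_rev mono_adj_sym)
  then have "mono_path (host N D L) c a ?xs"
    using dist disj ynot by (auto simp: mono_path_def)
  moreover have "length ?xs = Suc (2 * L)" using len by simp
  ultimately show False using no_path a by blast
qed

lemma exists_sparse_ramsey_host:
  assumes l: "l \<ge> 1" "l \<le> 2 * L" and D: "D > 0" "D \<le> r" and rL: "L * (r - D) < r"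
  shows "\<exists>G :: nat graph. fin_simple_graph G \<and> is_ramsey (path_graph l) r G \<and> max_density G < real D"
proof -
  obtain n' where n': "pairs_arrow n' (Suc r) (D + Suc L)"
    using pairs_arrow_exists by blast
  define n where "n = Suc n'"
  have n: "pairs_arrow n (Suc r) (D + Suc L)"
    using n' unfolding n_def pairs_arrow_def by (metis Suc_leD)
  define m where "m = Suc L + Suc (2 ^ r) * n"
  define N where "N = m * r ^ D + n"
  have pos: "r > 0" "L > 0" "n > 0" using D l by (auto simp: n_def)
  let ?G = "host N D L"
  have simple: "fin_simple_graph ?G" using host_simple[OF D(1)] .
  have "is_ramsey (path_graph l) r ?G"
    unfolding is_ramsey_path_iff[OF simple l(1)]
  proof
    fix c assume c: "c \<in> edges ?G \<rightarrow> {..<r}"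
    obtain a xs where a: "a < r" and xs: "length xs = Suc (2 * L)" "mono_path ?G c a xs"
      using host_mono_path[OF c pos(1) D pos(2) rL _ _ _ _ n pos(3), of m]
      unfolding N_def m_def by auto
    have "successively (mono_adj ?G c a) (take (Suc l) xs @ drop (Suc l) xs)"
      using xs by (simp add: mono_path_def)
    then have "successively (mono_adj ?G c a) (take (Suc l) xs)"
      unfolding successively_append_iff by blast
    then show "\<exists>xs. \<exists>i<r. length xs = Suc l \<and> distinct xs \<and>
       successively (\<lambda>a b. {a, b} \<in> edges ?G \<and> c {a, b} = i) xs"
      using a xs l(2) by (intro exI[of _ "take (Suc l) xs"] exI[of _ a]) (auto simp: mono_path_def mono_adj_def)
  qed
  moreover have "N > 0" using pos by (simp add: N_def)
  ultimately show ?thesis using simple host_density[OF D(1)] by blast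
qed

section \<open>Transversals of large rank\<close>

text \<open>
  For \<open>R = card\<close> this is Hall's theorem, for a matroid rank function Rado's theorem. If some \<open>A e0\<close>
  has two elements \<open>x\<close> and \<open>y\<close>, then one of them can be deleted without violating the condition:
  from violating families \<open>J\<close> for \<open>x\<close> and \<open>K\<close> for \<open>y\<close>, submodularity would produce a violation
  of the original condition at \<open>insert e0 (J \<union> K)\<close> or at \<open>J \<inter> K\<close>. Once all \<open>A e\<close> are singletons,
  the condition is the conclusion.
\<close>

lemma submodular_transversal:
  fixes R :: "'b set \<Rightarrow> nat" and A :: "'a \<Rightarrow> 'b set"
  assumes E: "finite E" and U: "finite U"
    and mono: "\<And>X Y. X \<subseteq> Y \<Longrightarrow> Y \<subseteq> U \<Longrightarrow> R X \<le> R Y"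
    and submod: "\<And>X Y. X \<subseteq> U \<Longrightarrow> Y \<subseteq> U \<Longrightarrow> R (X \<union> Y) + R (X \<inter> Y) \<le> R X + R Y"
    and R0: "R {} = 0"
    and A: "\<And>e. e \<in> E \<Longrightarrow> A e \<subseteq> U"
    and cond: "\<And>J. J \<subseteq> E \<Longrightarrow> card J \<le> R (\<Union>(A ` J))"
  shows "\<exists>f. (\<forall>e\<in>E. f e \<in> A e) \<and> (\<forall>J\<subseteq>E. card J \<le> R (f ` J))"
  using A cond
proof (induction "\<Sum>e\<in>E. card (A e)" arbitrary: A rule: less_induct)
  case (less A)
  have fin: "finite (A e)" if "e \<in> E" for e using less.prems(1)[OF that] U finite_subset by blast
  show ?case
  proof (cases "\<forall>e\<in>E. card (A e) \<le> 1")
    case True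
    have "\<exists>x. A e = {x}" if "e \<in> E" for e
    proof -
      have "A e \<noteq> {}" using less.prems(2)[of "{e}"] that R0 by auto
      then have "card (A e) = 1" using True that fin[OF that] by (metis One_nat_def Suc_leI card_gt_0_iff le_antisym)
      then show ?thesis by (metis card_1_singletonE)
    qed
    then obtain f where f: "\<And>e. e \<in> E \<Longrightarrow> A e = {f e}" by metis
    have "\<Union>(A ` J) = f ` J" if "J \<subseteq> E" for J using f that by auto
    then show ?thesis using less.prems(2) f by (metis insertI1)
  next
    case False
    then obtain e0 where e0: "e0 \<in> E" "\<not> card (A e0) \<le> 1" by blast
    then obtain x y where xy: "x \<in> A e0" "y \<in> A e0" "x \<noteq> y"
      using fin[OF e0(1)] by (metis card_le_Suc0_iff_eq One_nat_def)
    define B where "B z = A(e0 := A e0 - {z})" for z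
    have step: ?thesis if z: "z \<in> A e0" and c: "\<And>J. J \<subseteq> E \<Longrightarrow> card J \<le> R (\<Union>(B z ` J))" for z
    proof -
      have "(\<Sum>e\<in>E. card (B z e)) < (\<Sum>e\<in>E. card (A e))"
      proof (rule sum_strict_mono_ex1[OF E])
        show "\<forall>e\<in>E. card (B z e) \<le> card (A e)"
          using fin by (auto simp: B_def intro: card_mono)
        show "\<exists>e\<in>E. card (B z e) < card (A e)"
          using card_Diff1_less[OF fin[OF e0(1)] z] e0(1) by (intro bexI[of _ e0]) (simp_all add: B_def)
      qed
      moreover have "B z e \<subseteq> A e" for e by (auto simp: B_def)
      ultimately obtain f where "\<forall>e\<in>E. f e \<in> B z e" "\<forall>J\<subseteq>E. card J \<le> R (f ` J)"
        using less.hyps[of "B z"] c less.prems(1) by (metis subset_trans)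
      then show ?thesis using \<open>\<And>e. B z e \<subseteq> A e\<close> by blast
    qed
    have bad: ?thesis if z: "z \<in> A e0" and no: "\<not> (\<exists>J\<subseteq>E - {e0}. R ((A e0 - {z}) \<union> \<Union>(A ` J)) \<le> card J)" for z
    proof (rule step[OF z])
      fix J assume J: "J \<subseteq> E"
      show "card J \<le> R (\<Union>(B z ` J))"
      proof (cases "e0 \<in> J")
        case True
        let ?J = "J - {e0}"
        have "\<not> R ((A e0 - {z}) \<union> \<Union>(A ` ?J)) \<le> card ?J" using no J by blast
        moreover have "(A e0 - {z}) \<union> \<Union>(A ` ?J) = \<Union>(B z ` J)" using True by (auto simp: B_def)
        moreover have "card J = Suc (card ?J)"
          using True J E by (metis card.remove finite_subset)
        ultimately show ?thesis by simp
      next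
        case False
        then have "B z ` J = A ` J" by (auto simp: B_def)
        then show ?thesis using less.prems(2)[OF J] by simp
      qed
    qed
    show ?thesis
    proof (rule ccontr)
      assume no: "\<not> ?thesis"
      obtain J K where J: "J \<subseteq> E - {e0}" "R ((A e0 - {x}) \<union> \<Union>(A ` J)) \<le> card J"
        and K: "K \<subseteq> E - {e0}" "R ((A e0 - {y}) \<union> \<Union>(A ` K)) \<le> card K"
        using bad[OF xy(1)] bad[OF xy(2)] no by blast
      let ?X = "(A e0 - {x}) \<union> \<Union>(A ` J)" and ?Y = "(A e0 - {y}) \<union> \<Union>(A ` K)"
      have sub: "?X \<subseteq> U" "?Y \<subseteq> U" using less.prems(1) e0(1) J(1) K(1) by blast+
      have "Suc (card (J \<union> K)) = card (insert e0 (J \<union> K))"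
        using J(1) K(1) E by (subst card_insert_disjoint) (auto intro: finite_subset)
      also have "\<dots> \<le> R (\<Union>(A ` insert e0 (J \<union> K)))"
        using J(1) K(1) e0(1) by (intro less.prems(2)) auto
      also have "\<dots> \<le> R (?X \<union> ?Y)" using sub xy(3) by (intro mono) auto
      finally have 1: "Suc (card (J \<union> K)) \<le> R (?X \<union> ?Y)" .
      have "card (J \<inter> K) \<le> R (\<Union>(A ` (J \<inter> K)))" using J(1) by (intro less.prems(2)) auto
      also have "\<dots> \<le> R (?X \<inter> ?Y)" using sub by (intro mono) auto
      finally have 2: "card (J \<inter> K) \<le> R (?X \<inter> ?Y)" .
      have "card J + card K = card (J \<union> K) + card (J \<inter> K)"
        using J(1) K(1) E by (intro card_Un_Int) (auto intro: finite_subset)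
      then show False using 1 2 submod[OF sub] J(2) K(2) by linarith
    qed
  qed
qed

section \<open>Two-colouring a functional graph\<close>

text \<open>
  Let \<open>R\<close> be a smallest set that every orbit of \<open>f\<close> meets, and colour a vertex by the parity of the
  time at which its orbit first meets \<open>R\<close>. Outside \<open>R\<close> this time drops by one along \<open>f\<close>, so the
  exceptional vertices lie in \<open>R\<close>. By minimality the orbit of a member of \<open>R\<close> avoids all the other
  members, for otherwise that member could be dropped.
\<close>

lemma functional_graph_bipartition:
  fixes f :: "'a \<Rightarrow> 'a"
  assumes V: "finite V" and f: "f \<in> V \<rightarrow> V"
  shows "\<exists>(b :: 'a \<Rightarrow> bool) R. (\<forall>v\<in>V. b v = b (f v) \<longrightarrow> v \<in> R) \<and>
    (\<forall>a\<in>R. \<forall>e\<in>R. a \<noteq> e \<longrightarrow> f a \<noteq> e \<and> f (f a) \<noteq> f (f e))"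
proof -
  define hits where "hits R \<longleftrightarrow> R \<subseteq> V \<and> (\<forall>v\<in>V. \<exists>n. (f ^^ n) v \<in> R)" for R
  have "hits V" unfolding hits_def by (auto intro!: exI[of _ 0])
  then obtain R where R: "hits R" and min: "\<And>R'. hits R' \<Longrightarrow> card R \<le> card R'"
    using ex_has_least_nat[of hits V card] by auto
  have finR: "finite R" and RV: "R \<subseteq> V" using R V finite_subset unfolding hits_def by blast+
  have apart: "(f ^^ n) a \<noteq> e" if ae: "a \<in> R" "e \<in> R" "a \<noteq> e" for a e n
  proof
    assume n: "(f ^^ n) a = e"
    have "\<exists>m. (f ^^ m) v \<in> R - {a}" if v: "v \<in> V" for v
    proof -
      obtain m where m: "(f ^^ m) v \<in> R" using R v unfolding hits_def by blast
      show ?thesis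
      proof (cases "(f ^^ m) v = a")
        case True
        then have "(f ^^ (n + m)) v = e" using n by (simp add: funpow_add)
        then show ?thesis using ae by (intro exI[of _ "n + m"]) auto
      qed (use m in blast)
    qed
    then have "hits (R - {a})" using RV unfolding hits_def by auto
    then show False using min[of "R - {a}"] ae(1) finR by (metis card_Diff1_less leD)
  qed
  define d where "d v = (LEAST n. (f ^^ n) v \<in> R)" for v
  have d: "d v = Suc (d (f v))" if v: "v \<in> V" "v \<notin> R" for v
  proof -
    obtain n where "(f ^^ n) v \<in> R" using R v(1) unfolding hits_def by blast
    then show ?thesis unfolding d_def
      using v(2) by (subst Least_Suc[of _ n]) (auto simp: funpow_Suc_right simp del: funpow.simps(2))
  qed
  have "f (f a) \<noteq> f (f e)" if ae: "a \<in> R" "e \<in> R" "a \<noteq> e" for a e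
  proof
    assume eq: "f (f a) = f (f e)"
    have "f (f a) \<in> V" using ae RV f by blast
    then obtain n where n: "(f ^^ n) (f (f a)) \<in> R" using R unfolding hits_def by blast
    \<comment> \<open>The common orbit meets \<open>R\<close> at a point that must be both \<open>a\<close> and \<open>e\<close>.\<close>
    have "(f ^^ n) (f (f v)) = (f ^^ Suc (Suc n)) v" for v
      by (simp add: funpow_Suc_right del: funpow.simps(2))
    then show False using n eq apart[OF ae(1)] apart[OF ae(2)] ae(3) by metis
  qed
  moreover have "f a \<noteq> e" if "a \<in> R" "e \<in> R" "a \<noteq> e" for a e
    using apart[OF that, of 1] by simp
  moreover have "v \<in> R" if "v \<in> V" "even (d v) = even (d (f v))" for v
    using d[OF that(1)] that(2) by (metis even_Suc)
  ultimately show ?thesis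
    by (intro exI[of _ "\<lambda>v. even (d v)"] exI[of _ R]) blast
qed

section \<open>Colouring a graph of small density\<close>

text \<open>
  Hakimi's theorem: every edge picks one of its endpoints together with one of \<open>k\<close> slots there, and
  Hall's condition for these choices is the density condition. A slot number \<open>i\<close> stands for the
  functional graph formed by the edges with \<open>idx e = i\<close>.
\<close>

lemma orientation_exists:
  assumes fin: "finite E" and E: "E \<subseteq> [V]\<^bsup>2\<^esup>" "finite V"
    and dens: "\<And>J. J \<subseteq> E \<Longrightarrow> card J \<le> k * card (\<Union>J)"
  shows "\<exists>tail idx. (\<forall>e\<in>E. tail e \<in> e \<and> idx e < k) \<and> inj_on (\<lambda>e. (tail e, idx e :: nat)) E"
proof -
  have "\<exists>f. (\<forall>e\<in>E. f e \<in> e \<times> {..<k}) \<and> (\<forall>J\<subseteq>E. card J \<le> card (f ` J))"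
  proof (rule submodular_transversal[where U = "V \<times> {..<k}"])
    show "card J \<le> card (\<Union>e\<in>J. e \<times> {..<k})" if "J \<subseteq> E" for J
    proof -
      have "(\<Union>e\<in>J. e \<times> {..<k}) = \<Union>J \<times> {..<k}" by auto
      then show ?thesis using dens[OF that] by (simp add: card_cartesian_product mult.commute)
    qed
    show "card (X \<union> Y) + card (X \<inter> Y) \<le> card X + card Y"
      if "X \<subseteq> V \<times> {..<k}" "Y \<subseteq> V \<times> {..<k}" for X Y
    proof -
      have "finite X" "finite Y" using that E(2) finite_subset[of _ "V \<times> {..<k}"] by auto
      then show ?thesis using card_Un_Int[of X Y] by simp
    qed
    show "card X \<le> card Y" if "X \<subseteq> Y" "Y \<subseteq> V \<times> {..<k}" for X Y
      using that E(2) finite_subset[of Y "V \<times> {..<k}"] by (intro card_mono) auto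
  qed (use fin E in \<open>auto simp: nsets_def\<close>)
  then obtain f where f: "\<forall>e\<in>E. f e \<in> e \<times> {..<k}" "card E \<le> card (f ` E)" by blast
  then have "inj_on f E" using fin by (simp add: eq_card_imp_inj_on card_image_le le_antisym)
  then show ?thesis using f(1)
    by (intro exI[of _ "\<lambda>e. fst (f e)"] exI[of _ "\<lambda>e. snd (f e)"]) (auto simp: mem_Times_iff)
qed

text \<open>
  Two edges of the same slot cannot both leave their common vertex. A path inside one functional
  graph thus runs along its edges for some steps and against them from then on.
\<close>

lemma tail_of_consecutive_edges:
  assumes inj: "inj_on (\<lambda>e. (tail e, idx e)) E" and tail: "\<forall>e\<in>E. tail e \<in> e"
    and e: "{u, v} \<in> E" "{v, w} \<in> E" "idx {u, v} = idx {v, w}" and uw: "u \<noteq> w"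
  shows "tail {u, v} = u \<or> tail {v, w} = w"
proof -
  have "{u, v} \<noteq> {v, w}" using uw by (auto simp: doubleton_eq_iff)
  then have "tail {u, v} \<noteq> tail {v, w}" using inj e by (metis (no_types, lifting) inj_onD)
  then show ?thesis using bspec[OF tail e(1)] bspec[OF tail e(2)] by auto
qed

text \<open>
  On a monochromatic path all tails carry the same vertex colour, so a vertex whose outgoing path
  edge is followed by another one in the same direction is exceptional in the sense of
  \<open>functional_graph_bipartition\<close>. A path with four edges has either two edges in each direction, and
  then two exceptional vertices with the same second iterate, or at least three in one direction, and then
  two exceptional vertices that are consecutive. Both are excluded.
\<close>

lemma coloring_without_mono_P4:
  assumes E: "E \<subseteq> [V]\<^bsup>2\<^esup>" and V: "finite V"
    and dens: "\<And>J. J \<subseteq> E \<Longrightarrow> card J \<le> k * card (\<Union>J)"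
  shows "\<exists>c \<in> E \<rightarrow> {..<2 * k}. \<forall>a xs. distinct xs \<longrightarrow>
    successively (\<lambda>u v. {u, v} \<in> E \<and> c {u, v} = a) xs \<longrightarrow> length xs < 5"
proof -
  have fin: "finite E" using E V finite_imp_finite_nsets finite_subset by blast
  obtain tail idx where ti: "\<forall>e\<in>E. tail e \<in> e \<and> idx e < k" and inj: "inj_on (\<lambda>e. (tail e, idx e :: nat)) E"
    using orientation_exists[OF fin E V dens] by blast
  \<comment> \<open>Vertices without an outgoing edge in slot \<open>i\<close> become fixed points, so that \<open>f i\<close> is total on \<open>V\<close>.\<close>
  define f where "f i v = (if \<exists>e\<in>E. idx e = i \<and> tail e = v
      then SOME w. {v, w} \<in> E \<and> idx {v, w} = i \<and> tail {v, w} = v else v)" for i v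
  have f: "f i u = v" if e: "{u, v} \<in> E" "idx {u, v} = i" "tail {u, v} = u" for i u v
  proof -
    have "\<exists>e\<in>E. idx e = i \<and> tail e = u" using e by blast
    then have "f i u = (SOME w. {u, w} \<in> E \<and> idx {u, w} = i \<and> tail {u, w} = u)"
      unfolding f_def by (rule if_P)
    also have "\<dots> = v"
    proof (rule some_equality)
      fix w assume w: "{u, w} \<in> E \<and> idx {u, w} = i \<and> tail {u, w} = u"
      have "{u, w} = {u, v}" by (rule inj_onD[OF inj]) (use w e in simp_all)
      then show "w = v" by (auto simp: doubleton_eq_iff)
    qed (use e in auto)
    finally show ?thesis .
  qed
  have fV: "f i \<in> V \<rightarrow> V" for i
  proof
    fix v assume v: "v \<in> V"
    show "f i v \<in> V"
    proof (cases "\<exists>e\<in>E. idx e = i \<and> tail e = v")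
      case True
      then obtain e where e: "e \<in> E" "idx e = i" "tail e = v" by blast
      moreover obtain x y where xy: "e = {x, y}" "x \<in> V" "y \<in> V"
        using e(1) E by (auto elim!: nsets2_E)
      moreover have "tail e \<in> e" using ti e(1) by blast
      ultimately obtain w where "e = {v, w}" "w \<in> V" by (metis insertE insert_commute singletonD)
      then show ?thesis using f e by metis
    next
      case False
      then have "f i v = v" unfolding f_def by (rule if_not_P)
      then show ?thesis using v by simp
    qed
  qed
  have bip: "\<forall>i. \<exists>(b :: 'a \<Rightarrow> bool) R. (\<forall>v\<in>V. b v = b (f i v) \<longrightarrow> v \<in> R) \<and>
    (\<forall>a\<in>R. \<forall>e\<in>R. a \<noteq> e \<longrightarrow> f i a \<noteq> e \<and> f i (f i a) \<noteq> f i (f i e))"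
    by (intro allI functional_graph_bipartition[OF V fV])
  then obtain b :: "nat \<Rightarrow> 'a \<Rightarrow> bool" and R where bR: "\<And>i v. v \<in> V \<Longrightarrow> b i v = b i (f i v) \<Longrightarrow> v \<in> R i"
    and R: "\<And>i a e. a \<in> R i \<Longrightarrow> e \<in> R i \<Longrightarrow> a \<noteq> e \<Longrightarrow> f i a \<noteq> e \<and> f i (f i a) \<noteq> f i (f i e)"
  proof -
    from choice[OF bip] obtain b :: "nat \<Rightarrow> 'a \<Rightarrow> bool" where b: "\<forall>i. \<exists>R. (\<forall>v\<in>V. b i v = b i (f i v) \<longrightarrow> v \<in> R) \<and>
      (\<forall>a\<in>R. \<forall>e\<in>R. a \<noteq> e \<longrightarrow> f i a \<noteq> e \<and> f i (f i a) \<noteq> f i (f i e))" ..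
    from choice[OF b] obtain R where R: "\<forall>i. (\<forall>v\<in>V. b i v = b i (f i v) \<longrightarrow> v \<in> R i) \<and>
      (\<forall>a\<in>R i. \<forall>e\<in>R i. a \<noteq> e \<longrightarrow> f i a \<noteq> e \<and> f i (f i a) \<noteq> f i (f i e))" ..
    show thesis
    proof (rule that)
      show "v \<in> R i" if "v \<in> V" "b i v = b i (f i v)" for i v using R that by blast
      show "f i a \<noteq> e \<and> f i (f i a) \<noteq> f i (f i e)" if "a \<in> R i" "e \<in> R i" "a \<noteq> e" for i a e
        using R that by blast
    qed
  qed
  \<comment> \<open>The colour codes the slot and the vertex colour of the tail.\<close>
  define c where "c e = 2 * idx e + of_bool (b (idx e) (tail e))" for e
  have "c \<in> E \<rightarrow> {..<2 * k}" using ti by (auto simp: c_def of_bool_def)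
  moreover have "length xs < 5" if dist: "distinct xs"
    and succ: "successively (\<lambda>u v. {u, v} \<in> E \<and> c {u, v} = a) xs" for a xs
  proof (rule ccontr)
    assume "\<not> ?thesis"
    then have len: "4 < length xs" by simp
    define i \<beta> where "i = a div 2" and "\<beta> = (a mod 2 = 1)"
    have cd: "idx e = i" "b i (tail e) = \<beta>" if "c e = a" for e
      using that unfolding c_def i_def \<beta>_def by (auto simp: of_bool_def split: if_splits)
    have tail: "\<forall>e\<in>E. tail e \<in> e" using ti by blast
    obtain x0 x1 x2 x3 x4 ys where xs: "xs = x0 # x1 # x2 # x3 # x4 # ys"
      using len by (auto simp: eval_nat_numeral Suc_less_eq2 length_Suc_conv dest!: Suc_leI Suc_le_length_iff[THEN iffD1])
    have e: "{x0, x1} \<in> E" "{x1, x2} \<in> E" "{x2, x3} \<in> E" "{x3, x4} \<in> E"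
      and ca: "c {x0, x1} = a" "c {x1, x2} = a" "c {x2, x3} = a" "c {x3, x4} = a"
      using succ unfolding xs by auto
    have xV: "x0 \<in> V" "x1 \<in> V" "x2 \<in> V" "x3 \<in> V" "x4 \<in> V" using e E by auto
    have ne: "x0 \<noteq> x1" "x0 \<noteq> x2" "x1 \<noteq> x3" "x2 \<noteq> x4" "x3 \<noteq> x4" "x0 \<noteq> x4"
      "x1 \<noteq> x2" "x2 \<noteq> x3"
      using dist unfolding xs by auto
    have step: "f i u = v \<and> b i u = \<beta>" if "{u, v} \<in> E" "c {u, v} = a" "tail {u, v} = u" for u v
      using f[OF that(1) cd(1)[OF that(2)] that(3)] cd(2)[OF that(2)] that(3) by simp
    have step': "f i v = u \<and> b i v = \<beta>" if "{u, v} \<in> E" "c {u, v} = a" "tail {u, v} = v" for u v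
      using step[of v u] that by (simp add: insert_commute)
    have consec: "tail {u, v} = u \<or> tail {v, w} = w"
      if "{u, v} \<in> E" "{v, w} \<in> E" "c {u, v} = a" "c {v, w} = a" "u \<noteq> w" for u v w
      using tail_of_consecutive_edges[OF inj tail that(1,2) _ that(5)] cd(1) that(3,4) by simp
    have bad: "u \<in> R i" if "u \<in> V" "f i u = v \<and> b i u = \<beta>" "b i v = \<beta>" for u v
      using bR[OF that(1)] that(2,3) by simp
    show False
    proof (cases "tail {x1, x2} = x2")
      case False
      then have "tail {x0, x1} = x0" "tail {x1, x2} = x1"
        using consec[OF e(1,2) ca(1,2) ne(2)] tail e(2) by auto
      then have s0: "f i x0 = x1 \<and> b i x0 = \<beta>" and s1: "f i x1 = x2 \<and> b i x1 = \<beta>"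
        using step e ca by auto
      have bad0: "x0 \<in> R i" using bad[OF xV(1) s0] s1 by simp
      show False
      proof (cases "tail {x2, x3} = x3")
        case False
        then have "b i x2 = \<beta>" using step[OF e(3) ca(3)] tail e(3) by auto
        then have "x1 \<in> R i" using bad[OF xV(2) s1] by simp
        then show False using R[OF bad0 _ ne(1)] s0 by simp
      next
        case True
        moreover from True have "tail {x3, x4} = x4"
          using consec[OF e(3,4) ca(3,4) ne(4)] ne(8) by simp
        ultimately have s3: "f i x3 = x2 \<and> b i x3 = \<beta>" and s4: "f i x4 = x3 \<and> b i x4 = \<beta>"
          using step' e ca by auto
        have "x4 \<in> R i" using bad[OF xV(5) s4] s3 by simp
        then show False using R[OF bad0 _ ne(6)] s0 s1 s3 s4 by simp
      qed
    next
      case True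
      have t3: "tail {x2, x3} = x3" using consec[OF e(2,3) ca(2,3) ne(3)] True ne(7) by simp
      then have t4: "tail {x3, x4} = x4" using consec[OF e(3,4) ca(3,4) ne(4)] ne(8) by simp
      have s2: "f i x2 = x1 \<and> b i x2 = \<beta>" and s3: "f i x3 = x2 \<and> b i x3 = \<beta>"
        and s4: "f i x4 = x3 \<and> b i x4 = \<beta>"
        using step' True t3 t4 e ca by auto
      have "x3 \<in> R i" "x4 \<in> R i" using bad[OF xV(4) s3] bad[OF xV(5) s4] s2 s3 by auto
      then show False using R[of x4 i x3] s4 ne(5) by simp
    qed
  qed
  ultimately show ?thesis by blast
qed

section \<open>The graphic rank\<close>

definition component :: "'a set set \<Rightarrow> 'a \<Rightarrow> 'a set" where
  "component S v = {w. (v, w) \<in> {(a, b). {a, b} \<in> S}\<^sup>*}"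

lemma component_refl [simp]: "v \<in> component S v"
  by (simp add: component_def)

lemma component_eq: "w \<in> component S v \<Longrightarrow> component S w = component S v"
proof -
  have "sym ({(a, b). {a, b} \<in> S}\<^sup>*)" by (intro sym_rtrancl) (auto simp: sym_def insert_commute)
  then show "w \<in> component S v \<Longrightarrow> component S w = component S v"
    unfolding component_def by (auto dest: symD intro: rtrancl_trans)
qed

lemma component_eq_iff: "component S v = component S w \<longleftrightarrow> w \<in> component S v"
  using component_eq component_refl by metis

lemma component_edge: "{a, b} \<in> S \<Longrightarrow> b \<in> component S a"
  by (auto simp: component_def)

lemma component_mono: "S \<subseteq> T \<Longrightarrow> component S v \<subseteq> component T v"
  unfolding component_def using rtrancl_mono[of "{(a, b). {a, b} \<in> S}" "{(a, b). {a, b} \<in> T}"] by auto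

lemma component_least:
  assumes "v \<in> X" "\<And>a b. {a, b} \<in> S \<Longrightarrow> a \<in> X \<Longrightarrow> b \<in> X"
  shows "component S v \<subseteq> X"
proof
  fix w assume "w \<in> component S v"
  then have "(v, w) \<in> {(a, b). {a, b} \<in> S}\<^sup>*" by (simp add: component_def)
  then show "w \<in> X" by (induction rule: rtrancl_induct) (use assms in auto)
qed

lemma component_insert:
  "component (insert {a, b} S) v =
     (if v \<in> component S a \<union> component S b then component S a \<union> component S b else component S v)"
proof (cases "v \<in> component S a \<union> component S b")
  case True
  let ?T = "insert {a, b} S"
  have ab: "component ?T b = component ?T a" using component_eq[OF component_edge[of a b ?T]] by simp
  have "component ?T v \<subseteq> component S a \<union> component S b"
  proof (rule component_least[OF True])
    fix x y assume xy: "{x, y} \<in> ?T" "x \<in> component S a \<union> component S b"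
    show "y \<in> component S a \<union> component S b"
    proof (cases "{x, y} = {a, b}")
      case True
      then show ?thesis by (auto simp: doubleton_eq_iff)
    next
      case False
      then have "y \<in> component S x" using xy by (auto intro: component_edge)
      moreover have "component S x = component S a \<or> component S x = component S b"
        using xy(2) component_eq[of x S a] component_eq[of x S b] by auto
      ultimately show ?thesis by auto
    qed
  qed
  moreover have "v \<in> component ?T a" using True ab component_mono[of S ?T] by blast
  then have "component ?T v = component ?T a" by (rule component_eq)
  then have "component S a \<union> component S b \<subseteq> component ?T v" using ab component_mono[of S ?T] by blast
  ultimately show ?thesis using True by auto
next
  case False
  have "component (insert {a, b} S) v \<subseteq> component S v"
  proof (rule component_least)
    fix x y assume xy: "{x, y} \<in> insert {a, b} S" "x \<in> component S v"
    then have "x \<notin> component S a \<union> component S b" using False component_eq component_refl by (metis Un_iff)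
    then have "{x, y} \<in> S" using xy component_refl by (auto simp: doubleton_eq_iff)
    then show "y \<in> component S v" using xy(2) component_edge component_eq by metis
  qed simp
  then show ?thesis using False component_mono[of S "insert {a, b} S" v] by auto
qed

definition components :: "'a set \<Rightarrow> 'a set set \<Rightarrow> 'a set set" where
  "components V S = component S ` V"

lemma card_components_insert:
  assumes V: "finite V" and ab: "a \<in> V" "b \<in> V"
  shows "card (components V (insert {a, b} S)) + of_bool (component S a \<noteq> component S b) = card (components V S)"
proof -
  let ?A = "component S a" and ?B = "component S b"
  have mem: "?A \<in> components V S" "?B \<in> components V S" using ab by (auto simp: components_def)
  have fin: "finite (components V S)" using V by (simp add: components_def)
  have old: "component S v \<notin> {?A, ?B} \<longleftrightarrow> v \<notin> ?A \<union> ?B" for v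
    using component_eq component_refl by (metis UnE UnI1 UnI2 insertE insertI1 insert_commute singletonD)
  have image_if: "(\<lambda>v. if P v then c else g v) ` V = insert c (g ` {v\<in>V. \<not> P v})"
    if "P a" for P c and g :: "'a \<Rightarrow> 'a set"
    using that ab(1) by (auto simp: image_iff)
  have "components V S - {?A, ?B} = component S ` {v\<in>V. component S v \<notin> {?A, ?B}}"
    unfolding components_def by blast
  then have eq: "components V (insert {a, b} S) = insert (?A \<union> ?B) (components V S - {?A, ?B})"
    unfolding old using image_if[of "\<lambda>v. v \<in> ?A \<union> ?B" "?A \<union> ?B" "component S"]
    by (simp add: components_def component_insert)
  have "?A \<union> ?B \<notin> components V S - {?A, ?B}"
  proof
    assume "?A \<union> ?B \<in> components V S - {?A, ?B}"
    then obtain v where v: "?A \<union> ?B = component S v" "component S v \<noteq> ?A" by (auto simp: components_def)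
    then have "a \<in> component S v" using component_refl by (metis UnI1)
    then show False using v(2) component_eq by metis
  qed
  then have "card (components V (insert {a, b} S)) = Suc (card (components V S - {?A, ?B}))"
    unfolding eq using fin by simp
  moreover have "card (components V S - {?A, ?B}) = card (components V S) - card {?A, ?B}"
    using mem by (intro card_Diff_subset) auto
  moreover have "card {?A, ?B} \<le> card (components V S)" using mem fin by (intro card_mono) auto
  ultimately show ?thesis by (cases "?A = ?B") (auto simp: card_insert_if split: if_splits)
qed

text \<open>
  A new edge that joins two different components of the larger graph \<open>T\<close> does so in \<open>S\<close> too.
  Adding the edges of \<open>Z\<close> one by one turns this into submodularity of the rank.
\<close>

lemma card_components_union:
  assumes V: "finite V" and Z: "finite Z" "Z \<subseteq> [V]\<^bsup>2\<^esup>" and ST: "S \<subseteq> T"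
  shows "card (components V T) + card (components V (S \<union> Z)) \<le> card (components V (T \<union> Z)) + card (components V S)"
  using Z
proof (induction Z rule: finite_induct)
  case (insert e Z)
  then obtain a b where e: "e = {a, b}" "a \<in> V" "b \<in> V" by (auto elim!: nsets2_E)
  have "component (S \<union> Z) a = component (S \<union> Z) b \<Longrightarrow> component (T \<union> Z) a = component (T \<union> Z) b"
    using ST component_mono[of "S \<union> Z" "T \<union> Z" a] unfolding component_eq_iff by blast
  then have "of_bool (component (T \<union> Z) a \<noteq> component (T \<union> Z) b) \<le> (of_bool (component (S \<union> Z) a \<noteq> component (S \<union> Z) b) :: nat)"
    by auto
  moreover have "card (components V T) + card (components V (S \<union> Z))
      \<le> card (components V (T \<union> Z)) + card (components V S)"
    using insert by simp
  ultimately show ?case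
    using card_components_insert[OF V e(2,3), of "S \<union> Z"] card_components_insert[OF V e(2,3), of "T \<union> Z"]
    unfolding e(1) Un_insert_right by linarith
qed simp

lemma card_components_antimono:
  assumes V: "finite V" and T: "finite T" "T \<subseteq> [V]\<^bsup>2\<^esup>" and ST: "S \<subseteq> T"
  shows "card (components V T) \<le> card (components V S)"
proof -
  have "finite Z \<Longrightarrow> Z \<subseteq> [V]\<^bsup>2\<^esup> \<Longrightarrow> card (components V (S \<union> Z)) \<le> card (components V S)" for Z
  proof (induction Z rule: finite_induct)
    case (insert e Z)
    then obtain a b where e: "e = {a, b}" "a \<in> V" "b \<in> V" by (auto elim!: nsets2_E)
    then show ?case using insert card_components_insert[OF V e(2,3), of "S \<union> Z"]
      by (simp add: insert_subset)
  qed simp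
  from this[OF T] ST show ?thesis by (simp add: Un_absorb1)
qed

text \<open>
  The number of edges of a spanning forest of the graph on \<open>V\<close> with edge set \<open>S\<close>.
\<close>

definition graphic_rank :: "'a set \<Rightarrow> 'a set set \<Rightarrow> nat" where
  "graphic_rank V S = card V - card (components V S)"

lemma card_components_le: "finite V \<Longrightarrow> card (components V S) \<le> card V"
  unfolding components_def by (rule card_image_le)

lemma graphic_rank_empty: "graphic_rank V {} = 0"
proof -
  have "component {} v = {v}" for v :: 'a by (auto simp: component_def)
  then have "components V {} = (\<lambda>v. {v}) ` V" by (simp add: components_def)
  then show ?thesis by (simp add: graphic_rank_def card_image)
qed

lemma graphic_rank_mono:
  assumes "finite V" "T \<subseteq> [V]\<^bsup>2\<^esup>" "S \<subseteq> T"
  shows "graphic_rank V S \<le> graphic_rank V T"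
  using card_components_antimono[of V T S] assms finite_subset[OF assms(2)] finite_imp_finite_nsets
  unfolding graphic_rank_def by (metis diff_le_mono2)

lemma graphic_rank_submodular:
  assumes V: "finite V" and S: "S \<subseteq> [V]\<^bsup>2\<^esup>" "T \<subseteq> [V]\<^bsup>2\<^esup>"
  shows "graphic_rank V (S \<union> T) + graphic_rank V (S \<inter> T) \<le> graphic_rank V S + graphic_rank V T"
proof -
  have "finite S" using S V finite_subset finite_imp_finite_nsets by blast
  then have "card (components V T) + card (components V (S \<inter> T \<union> S)) \<le> card (components V (T \<union> S)) + card (components V (S \<inter> T))"
    using card_components_union[OF V, of S "S \<inter> T" T] S by blast
  moreover have "S \<inter> T \<union> S = S" "T \<union> S = S \<union> T" by auto
  ultimately show ?thesis
    using card_components_le[OF V, of S] card_components_le[OF V, of T] card_components_le[OF V, of "S \<inter> T"]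
      card_components_le[OF V, of "S \<union> T"]
    unfolding graphic_rank_def by simp
qed

lemma component_subset:
  assumes "S \<subseteq> [V]\<^bsup>2\<^esup>" "v \<in> V"
  shows "component S v \<subseteq> V"
  using assms by (intro component_least) auto

text \<open>
  Every vertex not covered by \<open>F\<close> is a component of its own, and the covered vertices contribute at
  least one more.
\<close>

lemma graphic_rank_less_card_Union:
  assumes V: "finite V" and F: "F \<subseteq> [V]\<^bsup>2\<^esup>" "F \<noteq> {}"
  shows "graphic_rank V F < card (\<Union>F)"
proof -
  have UV: "\<Union>F \<subseteq> V" using F(1) by (auto simp: nsets_def)
  obtain e where e: "e \<in> F" using F(2) by blast
  then have "card e = 2" using F(1) by (auto simp: nsets_def)
  then have "e \<noteq> {}" by auto
  then obtain a where a: "a \<in> \<Union>F" using e by blast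
  have single: "component F v = {v}" if "v \<notin> \<Union>F" for v
    using component_least[of v "{v}" F] that by auto
  let ?I = "(\<lambda>v. {v}) ` (V - \<Union>F)"
  have "insert (component F a) ?I \<subseteq> components V F"
    using a UV single by (auto simp: components_def image_iff)
  then have "card (insert (component F a) ?I) \<le> card (components V F)"
    using V by (intro card_mono) (auto simp: components_def)
  moreover have "component F a \<notin> ?I"
  proof
    assume "component F a \<in> ?I"
    then obtain v where "v \<notin> \<Union>F" "component F a = {v}" by blast
    then show False using a component_refl[of a F] by (metis singletonD)
  qed
  then have "card (insert (component F a) ?I) = Suc (card (V - \<Union>F))"
    using V by (simp add: card_image)
  moreover have "card (V - \<Union>F) = card V - card (\<Union>F)" "card (\<Union>F) \<le> card V"
    using UV V by (auto intro: card_Diff_subset finite_subset card_mono)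
  moreover have "card (\<Union>F) > 0" using a UV V by (metis card_gt_0_iff empty_iff finite_subset)
  ultimately show ?thesis unfolding graphic_rank_def by linarith
qed

text \<open>
  Summing the sparsity condition over the components gives the factor
  \<open>\<Sum>C. card C - 1 = graphic_rank V E\<close>.
\<close>

lemma card_le_graphic_rank:
  assumes V: "finite V" and E: "E \<subseteq> [V]\<^bsup>2\<^esup>"
    and sparse: "\<And>X. X \<subseteq> V \<Longrightarrow> X \<noteq> {} \<Longrightarrow> card {e\<in>E. e \<subseteq> X} \<le> k * (card X - 1)"
  shows "card E \<le> k * graphic_rank V E"
proof -
  have fin: "finite E" using E V finite_subset finite_imp_finite_nsets by blast
  have C: "C \<subseteq> V" "C \<noteq> {}" if mem: "C \<in> components V E" for C
  proof -
    obtain v where v: "v \<in> V" "C = component E v" using mem by (auto simp: components_def)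
    then show "C \<subseteq> V" using component_subset[OF E v(1)] by simp
    show "C \<noteq> {}" using v(2) component_refl[of v E] by (metis empty_iff)
  qed
  have finC: "finite (components V E)" using V by (simp add: components_def)
  have "E \<subseteq> (\<Union>C\<in>components V E. {e\<in>E. e \<subseteq> C})"
  proof
    fix e assume e: "e \<in> E"
    then obtain a b where ab: "e = {a, b}" "a \<in> V" using E by (auto elim!: nsets2_E)
    then have "e \<subseteq> component E a" using e component_edge by fastforce
    then show "e \<in> (\<Union>C\<in>components V E. {e\<in>E. e \<subseteq> C})" using e ab(2) by (auto simp: components_def)
  qed
  then have "card E \<le> card (\<Union>C\<in>components V E. {e\<in>E. e \<subseteq> C})" using fin finC by (intro card_mono) auto
  also have "\<dots> \<le> (\<Sum>C\<in>components V E. card {e\<in>E. e \<subseteq> C})" using finC by (rule card_UN_le)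
  also have "\<dots> \<le> (\<Sum>C\<in>components V E. k * (card C - 1))" using sparse C by (intro sum_mono) blast
  also have "\<dots> = k * (\<Sum>C\<in>components V E. card C - 1)" by (simp add: sum_distrib_left)
  also have "(\<Sum>C\<in>components V E. card C - 1) = graphic_rank V E"
  proof -
    have "pairwise disjnt (components V E)"
    proof (rule pairwiseI)
      fix X Y assume XY: "X \<in> components V E" "Y \<in> components V E" "X \<noteq> Y"
      then obtain x y where "X = component E x" "Y = component E y" by (auto simp: components_def)
      then show "disjnt X Y" using XY(3) component_eq unfolding disjnt_iff by metis
    qed
    moreover have "\<Union>(components V E) = V"
    proof
      show "\<Union>(components V E) \<subseteq> V" using C(1) by blast
      show "V \<subseteq> \<Union>(components V E)" unfolding components_def using component_refl by fast
    qed
    ultimately have "(\<Sum>C\<in>components V E. card C) = card V"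
      using card_Union_disjoint[of "components V E"] C(1) V finite_subset by metis
    moreover have "(\<Sum>C\<in>components V E. card C - 1) + (\<Sum>C\<in>components V E. 1) = (\<Sum>C\<in>components V E. card C)"
    proof (subst sum.distrib[symmetric], intro sum.cong refl)
      fix C assume "C \<in> components V E"
      then have "card C > 0" using C V by (metis card_gt_0_iff finite_subset)
      then show "card C - 1 + 1 = card C" by simp
    qed
    ultimately show ?thesis unfolding graphic_rank_def by simp
  qed
  finally show ?thesis .
qed

section \<open>Forests\<close>

text \<open>
  The theorem of Nash-Williams. Every edge \<open>e\<close> chooses an element \<open>(e, i)\<close> with \<open>i < k\<close>, and the rank
  of a set of such pairs is the sum over \<open>i\<close> of the graphic ranks of its slices. Being a forest is
  expressed by the rank inequality for all subsets.
\<close>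

lemma forest_partition:
  assumes V: "finite V" and E: "E \<subseteq> [V]\<^bsup>2\<^esup>"
    and sparse: "\<And>X. X \<subseteq> V \<Longrightarrow> X \<noteq> {} \<Longrightarrow> card {e\<in>E. e \<subseteq> X} \<le> k * (card X - 1)"
  shows "\<exists>idx. (\<forall>e\<in>E. idx e < k) \<and>
    (\<forall>i. \<forall>J \<subseteq> {e\<in>E. idx e = i}. card J \<le> graphic_rank V J)"
proof -
  have fin: "finite E" using E V finite_subset finite_imp_finite_nsets by blast
  define R where "R X = (\<Sum>i<k. graphic_rank V {e. (e, i) \<in> X})" for X :: "('a set \<times> nat) set"
  have sl: "{e. (e, i) \<in> X} \<subseteq> [V]\<^bsup>2\<^esup>" if "X \<subseteq> E \<times> {..<k}" for X i using that E by auto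
  have "\<exists>f. (\<forall>e\<in>E. f e \<in> {e} \<times> {..<k}) \<and> (\<forall>J\<subseteq>E. card J \<le> R (f ` J))"
  proof (rule submodular_transversal[where U = "E \<times> {..<k}"])
    show "R X \<le> R Y" if "X \<subseteq> Y" "Y \<subseteq> E \<times> {..<k}" for X Y
      unfolding R_def by (intro sum_mono graphic_rank_mono[OF V] sl[OF that(2)]) (use that in auto)
    show "R (X \<union> Y) + R (X \<inter> Y) \<le> R X + R Y" if XY: "X \<subseteq> E \<times> {..<k}" "Y \<subseteq> E \<times> {..<k}" for X Y
      unfolding R_def sum.distrib[symmetric]
    proof (rule sum_mono)
      fix i
      have "{e. (e, i) \<in> X \<union> Y} = {e. (e, i) \<in> X} \<union> {e. (e, i) \<in> Y}"
        "{e. (e, i) \<in> X \<inter> Y} = {e. (e, i) \<in> X} \<inter> {e. (e, i) \<in> Y}" by auto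
      then show "graphic_rank V {e. (e, i) \<in> X \<union> Y} + graphic_rank V {e. (e, i) \<in> X \<inter> Y}
        \<le> graphic_rank V {e. (e, i) \<in> X} + graphic_rank V {e. (e, i) \<in> Y}"
        using graphic_rank_submodular[OF V sl[OF XY(1)] sl[OF XY(2)]] by simp
    qed
    show "card J \<le> R (\<Union>e\<in>J. {e} \<times> {..<k})" if J: "J \<subseteq> E" for J
    proof -
      have "card J \<le> k * graphic_rank V J"
      proof (rule card_le_graphic_rank[OF V])
        show "J \<subseteq> [V]\<^bsup>2\<^esup>" using J E by blast
        show "card {e\<in>J. e \<subseteq> X} \<le> k * (card X - 1)" if "X \<subseteq> V" "X \<noteq> {}" for X
        proof -
          have "card {e\<in>J. e \<subseteq> X} \<le> card {e\<in>E. e \<subseteq> X}" using fin J by (intro card_mono) auto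
          then show ?thesis using sparse[OF that] by simp
        qed
      qed
      moreover have "{e. (e, i) \<in> (\<Union>e\<in>J. {e} \<times> {..<k})} = J" if "i < k" for i using that by auto
      ultimately show ?thesis unfolding R_def by simp
    qed
  qed (use fin in \<open>auto simp: R_def graphic_rank_empty\<close>)
  then obtain f where f: "\<And>e. e \<in> E \<Longrightarrow> f e \<in> {e} \<times> {..<k}" "\<And>J. J \<subseteq> E \<Longrightarrow> card J \<le> R (f ` J)" by blast
  have "card J \<le> graphic_rank V J" if J: "J \<subseteq> {e\<in>E. snd (f e) = i}" for i J
  proof (cases "i < k")
    case True
    have fe: "f e = (e, i)" if "e \<in> J" for e
    proof -
      have "e \<in> E" "snd (f e) = i" using J that by auto
      then show ?thesis using f(1) by (metis mem_Times_iff prod.collapse singletonD)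
    qed
    then have "f ` J = J \<times> {i}" by auto
    moreover have "{e. (e, i') \<in> J \<times> {i}} = (if i' = i then J else {})" for i' by auto
    ultimately have "R (f ` J) = (\<Sum>i'<k. if i' = i then graphic_rank V J else 0)"
      unfolding R_def by (intro sum.cong) (auto simp: graphic_rank_empty)
    also have "\<dots> = graphic_rank V J" using True by simp
    finally show ?thesis using f(2)[of J] J by auto
  next
    case False
    then have "J = {}" using J f(1) by fastforce
    then show ?thesis by simp
  qed
  then show ?thesis using f(1) by (intro exI[of _ "\<lambda>e. snd (f e)"]) (auto simp: mem_Times_iff)
qed

text \<open>
  Otherwise all degrees are at least 2, and double counting incidences gives
  \<open>card (\<Union>F) \<le> card F\<close>.
\<close>

lemma leaf_exists:
  assumes fin: "finite F" and F: "\<And>e. e \<in> F \<Longrightarrow> card e = 2" and less: "card F < card (\<Union>F)"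
  obtains u e where "e \<in> F" "u \<in> e" "u \<notin> \<Union>(F - {e})"
proof -
  have finU: "finite (\<Union>F)" using fin F by (metis card_eq_0_iff finite_Union zero_neq_numeral)
  have "\<exists>u\<in>\<Union>F. card {e\<in>F. u \<in> e} < 2"
  proof (rule ccontr)
    assume "\<not> ?thesis"
    then have "(\<Sum>u\<in>\<Union>F. 2) \<le> (\<Sum>u\<in>\<Union>F. card {e\<in>F. u \<in> e})"
      by (intro sum_mono) (meson linorder_not_less)
    also have "\<dots> = (\<Sum>e\<in>F. 2)"
    proof (rule sum_multicount_gen[OF finU fin], rule ballI)
      fix e assume e: "e \<in> F"
      then have "{u\<in>\<Union>F. u \<in> e} = e" by auto
      then show "card {u\<in>\<Union>F. u \<in> e} = 2" using F[OF e] by simp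
    qed
    finally show False using less by simp
  qed
  then obtain u where u: "u \<in> \<Union>F" "card {e\<in>F. u \<in> e} < 2" by blast
  then obtain e where e: "e \<in> F" "u \<in> e" by blast
  have "e' = e" if "e' \<in> F" "u \<in> e'" for e'
  proof (rule ccontr)
    assume "e' \<noteq> e"
    then have "card {e, e'} = 2" by simp
    moreover have "card {e, e'} \<le> card {e\<in>F. u \<in> e}" using fin e that by (intro card_mono) auto
    ultimately show False using u(2) by simp
  qed
  then show thesis using that[of e u] e by blast
qed

text \<open>
  Remove a leaf edge; when it is put back, the leaf becomes its tail and receives the colour opposite
  to its neighbour. In contrast to the functional graphs above there are no exceptional vertices.
\<close>

lemma forest_bipartition:
  assumes V: "finite V" and "finite F" and "F \<subseteq> [V]\<^bsup>2\<^esup>"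
    and "\<forall>J\<subseteq>F. card J \<le> graphic_rank V J"
  shows "\<exists>(b :: 'a \<Rightarrow> bool) tail. (\<forall>e\<in>F. tail e \<in> e) \<and> inj_on tail F \<and>
    (\<forall>u v. {u, v} \<in> F \<longrightarrow> b u \<noteq> b v)"
  using assms(2-)
proof (induction F rule: finite_psubset_induct)
  case (psubset F)
  show ?case
  proof (cases "F = {}")
    case False
    have "card F < card (\<Union>F)"
      using graphic_rank_less_card_Union[OF V psubset.prems(1) False] psubset.prems(2) by fastforce
    moreover have "card e = 2" if "e \<in> F" for e using psubset.prems(1) that by (auto simp: nsets_def)
    ultimately obtain u e where e: "e \<in> F" "u \<in> e" and leaf: "u \<notin> \<Union>(F - {e})"
      using leaf_exists[OF psubset.hyps] by blast
    obtain v where v: "e = {u, v}" "u \<noteq> v"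
    proof -
      obtain x y where "e = {x, y}" "x \<noteq> y" using e(1) psubset.prems(1) by (auto elim!: nsets2_E)
      then show thesis using e(2) that by (metis insertE insert_commute singletonD)
    qed
    have "\<exists>(b :: 'a \<Rightarrow> bool) tail. (\<forall>e'\<in>F - {e}. tail e' \<in> e') \<and> inj_on tail (F - {e}) \<and>
      (\<forall>u v. {u, v} \<in> F - {e} \<longrightarrow> b u \<noteq> b v)"
      using e(1) psubset.prems by (intro psubset.IH) auto
    then obtain b :: "'a \<Rightarrow> bool" and tail where
      bt: "(\<forall>e'\<in>F - {e}. tail e' \<in> e') \<and> inj_on tail (F - {e}) \<and>
        (\<forall>u v. {u, v} \<in> F - {e} \<longrightarrow> b u \<noteq> b v)" by (elim exE)
    have b: "\<And>x y. {x, y} \<in> F - {e} \<Longrightarrow> b x \<noteq> b y"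
      and t: "\<And>e'. e' \<in> F - {e} \<Longrightarrow> tail e' \<in> e'" "inj_on tail (F - {e})"
      using bt by simp_all
    let ?b = "b(u := \<not> b v)" and ?t = "tail(e := u)"
    have "\<forall>e'\<in>F. ?t e' \<in> e'" using e(2) t(1) by auto
    moreover have "inj_on ?t F"
    proof (rule inj_onI)
      fix x y assume xy: "x \<in> F" "y \<in> F" "?t x = ?t y"
      have "tail z \<noteq> u" if "z \<in> F" "z \<noteq> e" for z using t(1)[of z] leaf that by auto
      then show "x = y" using xy inj_onD[OF t(2), of x y] by (auto split: if_splits)
    qed
    moreover have "?b x \<noteq> ?b y" if xy: "{x, y} \<in> F" for x y
    proof (cases "{x, y} = e")
      case True
      then show ?thesis using v by (auto simp: doubleton_eq_iff)
    next
      case False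
      then have "{x, y} \<in> F - {e}" using xy by blast
      moreover from this have "x \<noteq> u" "y \<noteq> u" using leaf by auto
      ultimately show ?thesis using b[of x y] by simp
    qed
    ultimately show ?thesis by blast
  qed auto
qed

text \<open>
  On a path with three edges inside one forest two consecutive edges point in the same direction.
  Their tails are adjacent, hence of different vertex colours, so the two edges differ in colour.
\<close>

lemma coloring_without_mono_P3:
  assumes V: "finite V" and E: "E \<subseteq> [V]\<^bsup>2\<^esup>"
    and sparse: "\<And>X. X \<subseteq> V \<Longrightarrow> X \<noteq> {} \<Longrightarrow> card {e\<in>E. e \<subseteq> X} \<le> k * (card X - 1)"
  shows "\<exists>c \<in> E \<rightarrow> {..<2 * k}. \<forall>a xs. distinct xs \<longrightarrow>
    successively (\<lambda>u v. {u, v} \<in> E \<and> c {u, v} = a) xs \<longrightarrow> length xs < 4"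
proof -
  have fin: "finite E" using E V finite_imp_finite_nsets finite_subset by blast
  obtain idx where idx: "\<And>e. e \<in> E \<Longrightarrow> idx e < k"
    and forest: "\<And>i J. J \<subseteq> {e\<in>E. idx e = i} \<Longrightarrow> card J \<le> graphic_rank V J"
    using forest_partition[OF V E sparse] by blast
  have "\<forall>i. \<exists>p :: ('a \<Rightarrow> bool) \<times> ('a set \<Rightarrow> 'a). (\<forall>e\<in>{e\<in>E. idx e = i}. snd p e \<in> e) \<and>
    inj_on (snd p) {e\<in>E. idx e = i} \<and> (\<forall>u v. {u, v} \<in> {e\<in>E. idx e = i} \<longrightarrow> fst p u \<noteq> fst p v)"
  proof
    fix i
    have finE: "finite {e\<in>E. idx e = i}" using fin by simp
    have sub: "{e\<in>E. idx e = i} \<subseteq> [V]\<^bsup>2\<^esup>" using E by blast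
    have rk: "\<forall>J\<subseteq>{e\<in>E. idx e = i}. card J \<le> graphic_rank V J" using forest by simp
    obtain b :: "'a \<Rightarrow> bool" and tail where "(\<forall>e\<in>{e\<in>E. idx e = i}. tail e \<in> e) \<and>
      inj_on tail {e\<in>E. idx e = i} \<and> (\<forall>u v. {u, v} \<in> {e\<in>E. idx e = i} \<longrightarrow> b u \<noteq> b v)"
      using forest_bipartition[OF V finE sub rk] by (elim exE)
    then show "\<exists>p :: ('a \<Rightarrow> bool) \<times> ('a set \<Rightarrow> 'a). (\<forall>e\<in>{e\<in>E. idx e = i}. snd p e \<in> e) \<and>
    inj_on (snd p) {e\<in>E. idx e = i} \<and> (\<forall>u v. {u, v} \<in> {e\<in>E. idx e = i} \<longrightarrow> fst p u \<noteq> fst p v)"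
      by (intro exI[of _ "(b, tail)"]) simp
  qed
  from choice[OF this] obtain p :: "nat \<Rightarrow> ('a \<Rightarrow> bool) \<times> ('a set \<Rightarrow> 'a)" where
    ps: "\<forall>i. (\<forall>e\<in>{e\<in>E. idx e = i}. snd (p i) e \<in> e) \<and> inj_on (snd (p i)) {e\<in>E. idx e = i} \<and>
      (\<forall>u v. {u, v} \<in> {e\<in>E. idx e = i} \<longrightarrow> fst (p i) u \<noteq> fst (p i) v)" ..
  have p: "snd (p i) e \<in> e" if "e \<in> E" "idx e = i" for e i using ps that by blast
  have p_inj: "inj_on (snd (p i)) {e\<in>E. idx e = i}" for i using ps by blast
  have p_bip: "fst (p i) u \<noteq> fst (p i) v" if "{u, v} \<in> E" "idx {u, v} = i" for i u v
    using ps that by simp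
  define tail where "tail e = snd (p (idx e)) e" for e
  define b where "b i = fst (p i)" for i
  have tail: "\<forall>e\<in>E. tail e \<in> e" using p by (simp add: tail_def)
  have inj: "inj_on (\<lambda>e. (tail e, idx e)) E"
  proof (rule inj_onI)
    fix x y assume xy: "x \<in> E" "y \<in> E" "(tail x, idx x) = (tail y, idx y)"
    then have idx: "idx x = idx y" and "tail x = tail y" by simp_all
    then have "snd (p (idx y)) x = snd (p (idx y)) y" by (simp add: tail_def)
    then show "x = y" by (rule inj_onD[OF p_inj]) (use xy(1,2) idx in simp_all)
  qed
  define c where "c e = 2 * idx e + of_bool (b (idx e) (tail e))" for e
  have "c \<in> E \<rightarrow> {..<2 * k}" using idx by (fastforce simp: c_def of_bool_def)
  moreover have "length xs < 4" if dist: "distinct xs"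
    and succ: "successively (\<lambda>u v. {u, v} \<in> E \<and> c {u, v} = a) xs" for a xs
  proof (rule ccontr)
    assume "\<not> ?thesis"
    then have len: "3 < length xs" by simp
    define i \<beta> where "i = a div 2" and "\<beta> = (a mod 2 = 1)"
    have cd: "idx e = i" "b i (tail e) = \<beta>" if "c e = a" for e
      using that unfolding c_def i_def \<beta>_def by (auto simp: of_bool_def split: if_splits)
    obtain x0 x1 x2 x3 ys where xs: "xs = x0 # x1 # x2 # x3 # ys"
      using len by (auto simp: eval_nat_numeral Suc_less_eq2 length_Suc_conv dest!: Suc_leI Suc_le_length_iff[THEN iffD1])
    have e: "{x0, x1} \<in> E" "{x1, x2} \<in> E" "{x2, x3} \<in> E"
      and ca: "c {x0, x1} = a" "c {x1, x2} = a" "c {x2, x3} = a"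
      using succ unfolding xs by auto
    have ne: "x0 \<noteq> x2" "x1 \<noteq> x3" "x1 \<noteq> x2" using dist unfolding xs by auto
    have bip: "b i u \<noteq> b i v" if "{u, v} \<in> E" "c {u, v} = a" for u v
      using p_bip[OF that(1) cd(1)[OF that(2)]] by (simp add: b_def)
    have consec: "tail {u, v} = u \<or> tail {v, w} = w"
      if "{u, v} \<in> E" "{v, w} \<in> E" "c {u, v} = a" "c {v, w} = a" "u \<noteq> w" for u v w
      using tail_of_consecutive_edges[OF inj tail that(1,2) _ that(5)] cd(1) that(3,4) by simp
    show False
    proof (cases "tail {x1, x2} = x2")
      case False
      then have "tail {x0, x1} = x0" "tail {x1, x2} = x1"
        using consec[OF e(1,2) ca(1,2) ne(1)] tail e(2) by auto
      then have "b i x0 = \<beta>" "b i x1 = \<beta>" using cd(2)[OF ca(1)] cd(2)[OF ca(2)] by auto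
      then show False using bip[OF e(1) ca(1)] by simp
    next
      case True
      then have "tail {x2, x3} = x3" using consec[OF e(2,3) ca(2,3) ne(2)] ne(3) by auto
      then have "b i x2 = \<beta>" "b i x3 = \<beta>" using cd(2)[OF ca(2)] cd(2)[OF ca(3)] True by auto
      then show False using bip[OF e(3) ca(3)] by simp
    qed
  qed
  ultimately show ?thesis by blast
qed

section \<open>The bounds\<close>

lemma not_is_ramsey_if_coloring:
  assumes G: "fin_simple_graph G" and l: "l \<ge> 1" and kr: "2 * k \<le> r"
    and c: "\<exists>c \<in> edges G \<rightarrow> {..<2 * k}. \<forall>a xs. distinct xs \<longrightarrow>
      successively (\<lambda>u v. {u, v} \<in> edges G \<and> c {u, v} = a) xs \<longrightarrow> length xs < Suc l"
  shows "\<not> is_ramsey (path_graph l) r G"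
proof
  assume R: "is_ramsey (path_graph l) r G"
  obtain c where c: "c \<in> edges G \<rightarrow> {..<2 * k}" and short: "\<And>a xs. distinct xs \<Longrightarrow>
      successively (\<lambda>u v. {u, v} \<in> edges G \<and> c {u, v} = a) xs \<Longrightarrow> length xs < Suc l"
    using c by blast
  have "c e < r" if "e \<in> edges G" for e
    using Pi_mem[OF c that] kr by simp
  then have "c \<in> edges G \<rightarrow> {..<r}" by simp
  then obtain xs i where "length xs = Suc l" "distinct xs"
    "successively (\<lambda>a b. {a, b} \<in> edges G \<and> c {a, b} = i) xs"
    using R unfolding is_ramsey_path_iff[OF G l] by blast
  then show False using short by fastforce
qed

lemma max_density_ge_of_ramsey_path:
  assumes G: "fin_simple_graph G" and l: "l \<ge> 4" and kr: "2 * k \<le> r"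
    and R: "is_ramsey (path_graph l) r G"
  shows "real k \<le> max_density G"
proof (rule ccontr)
  assume less: "\<not> ?thesis"
  have V: "finite (verts G)" "edges G \<subseteq> [verts G]\<^bsup>2\<^esup>" using G by (auto simp: fin_simple_graph_def)
  have "card J \<le> k * card (\<Union>J)" if J: "J \<subseteq> edges G" for J
  proof (cases "J = {}")
    case False
    have JV: "\<Union>J \<subseteq> verts G" "J \<subseteq> [\<Union>J]\<^bsup>2\<^esup>" using J V(2) by (auto simp: nsets_def)
    obtain e where e: "e \<in> J" using False by blast
    have "card e = 2" using e J V(2) by (auto simp: nsets_def)
    then have "e \<noteq> {}" by auto
    then have ne: "\<Union>J \<noteq> {}" using e by blast
    have fin: "finite (\<Union>J)" using JV(1) V(1) finite_subset by blast
    let ?H = "\<lparr>verts = \<Union>J, edges = J\<rparr>"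
    have "subgraph ?H G" using JV J fin by (auto simp: subgraph_def fin_simple_graph_def)
    then have "real (card J) / real (card (\<Union>J)) \<le> max_density G"
      using density_le_max_density[OF G, of ?H] ne by simp
    then have "real (card J) / real (card (\<Union>J)) \<le> real k" using less by linarith
    moreover have "card (\<Union>J) > 0" using ne fin by (simp add: card_gt_0_iff)
    ultimately have "real (card J) \<le> real k * real (card (\<Union>J))" by (simp add: pos_divide_le_eq)
    then show ?thesis by (metis of_nat_le_iff of_nat_mult)
  qed simp
  from coloring_without_mono_P4[OF V(2,1) this]
  obtain c where c: "c \<in> edges G \<rightarrow> {..<2 * k}" "\<And>a xs. distinct xs \<Longrightarrow>
      successively (\<lambda>u v. {u, v} \<in> edges G \<and> c {u, v} = a) xs \<Longrightarrow> length xs < 5"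
    by auto
  have "length xs < Suc l" if "distinct xs"
    "successively (\<lambda>u v. {u, v} \<in> edges G \<and> c {u, v} = a) xs" for a xs
    using c(2)[OF that] l by linarith
  then have "\<exists>c \<in> edges G \<rightarrow> {..<2 * k}. \<forall>a xs. distinct xs \<longrightarrow>
      successively (\<lambda>u v. {u, v} \<in> edges G \<and> c {u, v} = a) xs \<longrightarrow> length xs < Suc l"
    using c(1) by auto
  then show False using not_is_ramsey_if_coloring[OF G _ kr] R l by simp
qed

text \<open>
  A vertex set of size \<open>x \<le> 2 * k\<close> spans at most \<open>x * (x - 1) / 2 \<le> k * (x - 1)\<close> edges in any
  graph. From size \<open>2 * k + 1\<close> on, the density deficit times \<open>x\<close> is at least \<open>k - 1\<close>, which together
  with strictness and integrality is enough.
\<close>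

lemma edges_le_of_density:
  fixes x m k :: nat
  assumes k: "k \<ge> 1" and x: "x \<ge> 1" and choose: "2 * m \<le> x * (x - 1)"
    and dens: "real m < (real k - (real k - 1) / (2 * real k + 1)) * real x"
  shows "m \<le> k * (x - 1)"
proof (cases "x \<le> 2 * k")
  case True
  then have "x * (x - 1) \<le> 2 * k * (x - 1)" by (intro mult_le_mono1)
  then have "2 * m \<le> 2 * (k * (x - 1))" using choose by (simp only: mult.assoc)
  then show ?thesis by simp
next
  case False
  then have "real x \<ge> 2 * real k + 1" by linarith
  then have "(real k - 1) / (2 * real k + 1) * real x \<ge> (real k - 1) / (2 * real k + 1) * (2 * real k + 1)"
    using k by (intro mult_left_mono) auto
  also have "(real k - 1) / (2 * real k + 1) * (2 * real k + 1) = real k - 1" by (simp add: add_nonneg_eq_0_iff)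
  finally have "real m < real k * real x - (real k - 1)"
    using dens by (simp add: left_diff_distrib)
  also have "\<dots> = real (k * (x - 1)) + 1" using x by (simp add: of_nat_diff right_diff_distrib)
  finally show ?thesis by linarith
qed

lemma max_density_ge_of_ramsey_path_3:
  assumes G: "fin_simple_graph G" and k: "k \<ge> 1" and kr: "2 * k \<le> r"
    and R: "is_ramsey (path_graph 3) r G"
  shows "real k - (real k - 1) / (2 * real k + 1) \<le> max_density G"
proof (rule ccontr)
  assume less: "\<not> ?thesis"
  have V: "finite (verts G)" "edges G \<subseteq> [verts G]\<^bsup>2\<^esup>" using G by (auto simp: fin_simple_graph_def)
  have sparse: "card {e \<in> edges G. e \<subseteq> X} \<le> k * (card X - 1)" if X: "X \<subseteq> verts G" "X \<noteq> {}" for X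
  proof (rule edges_le_of_density[OF k])
    let ?E = "{e \<in> edges G. e \<subseteq> X}"
    have fin: "finite X" using X V finite_subset by blast
    then show pos: "card X \<ge> 1" using X(2) by (simp add: Suc_le_eq card_gt_0_iff)
    have EX: "?E \<subseteq> [X]\<^bsup>2\<^esup>" using V(2) by (auto simp: nsets_def)
    then have "card ?E \<le> card X choose 2"
      using card_mono[OF finite_imp_finite_nsets[OF fin]] by (metis card_nsets)
    then show "2 * card ?E \<le> card X * (card X - 1)"
      by (simp add: choose_two)
    let ?H = "\<lparr>verts = X, edges = ?E\<rparr>"
    have "subgraph ?H G" using EX X fin by (auto simp: subgraph_def fin_simple_graph_def)
    then have "real (card ?E) / real (card X) \<le> max_density G"
      using density_le_max_density[OF G, of ?H] X(2) by simp
    then have "real (card ?E) / real (card X) < real k - (real k - 1) / (2 * real k + 1)" using less by linarith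
    then show "real (card ?E) < (real k - (real k - 1) / (2 * real k + 1)) * real (card X)"
      using pos by (simp add: pos_divide_less_eq)
  qed
  have "\<exists>c \<in> edges G \<rightarrow> {..<2 * k}. \<forall>a xs. distinct xs \<longrightarrow>
      successively (\<lambda>u v. {u, v} \<in> edges G \<and> c {u, v} = a) xs \<longrightarrow> length xs < Suc 3"
    using coloring_without_mono_P3[OF V sparse] by simp
  then show False using not_is_ramsey_if_coloring[OF G _ kr] R by simp
qed

lemma ramsey_number_edge_le:
  assumes "r \<ge> 1"
  shows "ramsey_number (path_graph 1) r \<le> 2"
proof -
  have simple: "fin_simple_graph (complete_graph 2)"
    by (simp add: fin_simple_graph_def complete_graph_def)
  have e: "{0, 1} \<in> edges (complete_graph 2)"
    by (simp add: complete_graph_def del: nsets_self)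
  have "is_ramsey (path_graph 1) r (complete_graph 2)"
    unfolding is_ramsey_path_iff[OF simple order_refl]
  proof
    fix c assume "c \<in> edges (complete_graph 2) \<rightarrow> {..<r}"
    then have "c {0, 1} < r" using e by auto
    then show "\<exists>xs. \<exists>i<r. length xs = Suc 1 \<and> distinct xs \<and>
       successively (\<lambda>a b. {a, b} \<in> edges (complete_graph 2) \<and> c {a, b} = i) xs"
      using e by (intro exI[of _ "[0, 1]"] exI[of _ "c {0, 1}"]) simp
  qed
  then show ?thesis unfolding ramsey_number_def by (rule Least_le)
qed

lemma floor_half: "\<lfloor>real n / 2\<rfloor> = int (n div 2)"
  using floor_divide_of_nat_eq[of n 2, where ?'a = real] by simp

lemma ceiling_half: "\<lceil>real n / 2\<rceil> = int (Suc n div 2)"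
proof (cases "even n")
  case True
  then show ?thesis by (auto elim!: evenE)
next
  case False
  then obtain m where "n = 2 * m + 1" by (auto elim!: oddE)
  moreover have "\<lceil>(2 * real m + 1) / 2\<rceil> = int m + 1" by (intro ceiling_unique) auto
  ultimately show ?thesis by (simp add: add.commute)
qed

theorem theorem3:
  fixes l r :: nat and \<epsilon> :: real
  assumes "l \<ge> 3" and "r \<ge> 2"
    and "\<epsilon> = (real_of_int \<lfloor>real r / 2\<rfloor> - 1) /
           max (real (ramsey_number (path_graph (l div 3)) r)) (2 * real_of_int \<lfloor>real r / 2\<rfloor> + 1)"
  shows "\<epsilon> < 1 / 2 \<and>
         real_of_int \<lfloor>real r / 2\<rfloor> - \<epsilon> \<le> ramsey_density (path_graph l) r \<and>
         ramsey_density (path_graph l) r <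
           real_of_int \<lceil>(1 - 1 / real_of_int \<lceil>real l / 2\<rceil>) * real r + 1 / real_of_int \<lceil>real l / 2\<rceil>\<rceil>"
proof -
  define k where "k = r div 2"
  define L where "L = Suc l div 2"
  define D where "D = r - (r - 1) div L"
  define S where "S = {max_density G | G :: nat graph. fin_simple_graph G \<and> is_ramsey (path_graph l) r G}"
  have k: "k \<ge> 1" "2 * k \<le> r" using assms(2) unfolding k_def by auto
  have L: "L \<ge> 2" "l \<le> 2 * L" using assms(1) unfolding L_def by linarith+
  define M where "M = max (real (ramsey_number (path_graph (l div 3)) r)) (2 * real k + 1)"
  have eps: "\<epsilon> = (real k - 1) / M" using assms(3) by (simp add: floor_half k_def M_def)
  have M: "M \<ge> 2 * real k + 1" unfolding M_def by simp
  have M0: "M > 0" using M by linarith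
  have "\<epsilon> < 1 / 2"
    unfolding eps pos_divide_less_eq[OF M0] using M by linarith
  moreover have eps0: "\<epsilon> \<ge> 0" unfolding eps using M0 k(1) by (intro divide_nonneg_pos) auto
  have lower: "real k - \<epsilon> \<le> d" if dS: "d \<in> S" for d
  proof -
    obtain G :: "nat graph" where d: "d = max_density G" and G: "fin_simple_graph G"
      "is_ramsey (path_graph l) r G" using dS unfolding S_def by blast
    show ?thesis
    proof (cases "l = 3")
      case False
      then have "real k \<le> d" unfolding d
        using max_density_ge_of_ramsey_path[OF G(1) _ k(2) G(2)] assms(1) by simp
      then show ?thesis using eps0 by linarith
    next
      case True
      \<comment> \<open>The path with \<open>3 div 3 = 1\<close> edges has so small a Ramsey number that the maximum in \<open>\<epsilon>\<close> is its second argument.\<close>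
      have "real (ramsey_number (path_graph (l div 3)) r) \<le> 2"
        using ramsey_number_edge_le[of r] assms(2) True by simp
      then have "M = 2 * real k + 1" using k(1) unfolding M_def by (intro max_absorb2) linarith
      then show ?thesis
        using max_density_ge_of_ramsey_path_3[OF G(1) k] G(2) True unfolding d eps by simp
    qed
  qed
  have q: "L * ((r - 1) div L) \<le> r - 1" by simp
  have "(r - 1) div L \<le> r - 1" by (rule div_le_dividend)
  then have D: "D > 0" "D \<le> r" "r - D = (r - 1) div L" using assms(2) unfolding D_def by linarith+
  have "L * (r - D) < r" using q assms(2) unfolding D(3) by linarith
  then obtain G :: "nat graph" where G: "fin_simple_graph G" "is_ramsey (path_graph l) r G"
    and dG: "max_density G < real D"
    using exists_sparse_ramsey_host[OF _ L(2) D(1,2)] assms(1) by fastforce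
  have GS: "max_density G \<in> S" using G unfolding S_def by blast
  have dens: "ramsey_density (path_graph l) r = Inf S" by (simp add: ramsey_density_def S_def)
  have "real k - \<epsilon> \<le> ramsey_density (path_graph l) r"
    unfolding dens using GS lower by (intro cInf_greatest) auto
  moreover have "ramsey_density (path_graph l) r < real D"
  proof -
    have "Inf S \<le> max_density G" using GS lower by (intro cInf_lower bdd_belowI)
    then show ?thesis using dG dens by linarith
  qed
  moreover have "real D \<le> real_of_int \<lceil>(1 - 1 / real L) * real r + 1 / real L\<rceil>"
  proof -
    \<comment> \<open>The ceiling is at least \<open>D\<close> as soon as its argument exceeds \<open>D - 1\<close>.\<close>
    have "r - 1 < L * Suc ((r - 1) div L)" using L(1) dividend_less_times_div[of L "r - 1"] by simp
    then have "real (r - 1) < real L * real (Suc ((r - 1) div L))" by (metis of_nat_less_iff of_nat_mult)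
    then have "(real r - 1) / real L < real ((r - 1) div L) + 1"
      using L(1) assms(2) by (simp add: pos_divide_less_eq mult.commute add.commute of_nat_diff)
    moreover have "real D = real r - real ((r - 1) div L)"
      using D unfolding D_def by (simp add: of_nat_diff)
    moreover have "(1 - 1 / real L) * real r + 1 / real L = real r - (real r - 1) / real L"
      by (simp add: left_diff_distrib diff_divide_distrib)
    ultimately have "real D - 1 < (1 - 1 / real L) * real r + 1 / real L" by linarith
    then have "int D - 1 < \<lceil>(1 - 1 / real L) * real r + 1 / real L\<rceil>" by (simp add: less_ceiling_iff)
    then show ?thesis by linarith
  qed
  ultimately show ?thesis
    unfolding floor_half ceiling_half k_def[symmetric] L_def[symmetric] by simp
qed

end
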